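(* Let $(X_i)_{i\in\mathbb Z}$ and $(Y_j)_{j\in\mathbb Z}$ be random variables on a common probability space such that, $\mathcal M$ denoting the $\sigma$-metalgebra spanned by all the $X_i$ and all the $Y_j$, one has for all $i,j\in\mathbb Z$ $$\{X_i:Y_j\}_{\mathcal M}\ \le\ \epsilon(j-i)$$ for some function $\epsilon:\mathbb Z\to[0,1]$. Then, writing $\vec X=(X_i)_{i\in\mathbb Z}$ and $\vec Y=(Y_j)_{j\in\mathbb Z}$, $$\{\vec X:\vec Y\}\ \le\ \bar\epsilon,$$ where $\bar\epsilon\in[0,1]$ is characterized by $$\arcsin\bar\epsilon=\min\Big(\sum_{z\in\mathbb Z}\arcsin\epsilon(z),\ \frac{\pi}{2}\Big).$$
   Context: Random variables may take values in arbitrary measurable spaces. For random variables $X,Y$ the Hilbertian (maximal) correlation coefficient is $\{X:Y\}=\{\sigma(X):\sigma(Y)\}$ where, for $\sigma$-algebras $\mathcal F,\mathcal G$, $\{\mathcal F:\mathcal G\}$ is the supremum of $|\operatorname{Cov}(f,g)|/(\operatorname{sd}(f)\operatorname{sd}(g))$ over real square-integrable, not a.s. constant $f$ ($\mathcal F$-measurable) and $g$ ($\mathcal G$-measurable) ($0$ if one of the $\sigma$-algebras is trivial; $\operatorname{sd}$ is the standard deviation). Subjective correlation: for $\sigma$-algebras $\mathcal F,\mathcal G,\mathcal H$, $\{\mathcal F:\mathcal G\}_{\mathcal H}$ is the smallest $\epsilon\in[0,1]$ such that $|\mathbf E[fg]|\le\epsilon\operatorname{sd}(f)\operatorname{sd}(g)$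 for all real square-integrable $f$ ($\mathcal F\vee\mathcal H$-measurable) and $g$ ($\mathcal G\vee\mathcal H$-measurable) with $\mathbf E[f|\mathcal H]=\mathbf E[g|\mathcal H]=0$ a.s. (for variables $X,Y,Z$ this says $\{X:Y\}\le\epsilon$ under the conditional law given $Z=z$ for almost all $z$). The $\sigma$-metalgebra spanned by random variables $(Z_k)_{k\in K}$ is the set $\mathcal M$ of the $\sigma$-algebras $\sigma((Z_k)_{k\in K'})$, $K'\subset K$, and $\{X:Y\}_{\mathcal M}=\sup_{\mathcal H\in\mathcal M}\{\sigma(X):\sigma(Y)\}_{\mathcal H}$. *)

theory Defs
  imports "HOL-Probability.Probability"
begin

(* Sub-sigma-algebras of a probability space M are represented, as in
   HOL-Probability.Conditional_Expectation, by measures with carrier "space M";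
   only their measurable sets matter. *)

definition covar :: "'w measure \<Rightarrow> ('w \<Rightarrow> real) \<Rightarrow> ('w \<Rightarrow> real) \<Rightarrow> real" where
  "covar M f g = (\<integral>x. (f x - (\<integral>y. f y \<partial>M)) * (g x - (\<integral>y. g y \<partial>M)) \<partial>M)"

definition sd :: "'w measure \<Rightarrow> ('w \<Rightarrow> real) \<Rightarrow> real" where
  "sd M f = sqrt (\<integral>x. (f x - (\<integral>y. f y \<partial>M))\<^sup>2 \<partial>M)"

definition sq_integrable :: "'w measure \<Rightarrow> 'w measure \<Rightarrow> ('w \<Rightarrow> real) set" where
  "sq_integrable M F = {f \<in> borel_measurable F. integrable M (\<lambda>x. (f x)\<^sup>2)}"

definition as_constant :: "'w measure \<Rightarrow> ('w \<Rightarrow> real) \<Rightarrow> bool" where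
  "as_constant M f \<longleftrightarrow> (\<exists>c. AE x in M. f x = c)"

(* The ratios are nonnegative and, by Cauchy-Schwarz, at most 1, so the real supremum is
   meaningful; inserting 0 only has an effect if one of F, G is trivial, when there are
   no ratios at all. *)
definition max_corr :: "'w measure \<Rightarrow> 'w measure \<Rightarrow> 'w measure \<Rightarrow> real" where
  "max_corr M F G = Sup (insert 0 {\<bar>covar M f g\<bar> / (sd M f * sd M g) | f g.
     f \<in> sq_integrable M F \<and> \<not> as_constant M f \<and>
     g \<in> sq_integrable M G \<and> \<not> as_constant M g})"

definition sigma_join :: "'w measure \<Rightarrow> 'w measure \<Rightarrow> 'w measure \<Rightarrow> 'w measure" where
  "sigma_join M F G = sigma (space M) (sets F \<union> sets G)"

(* The admissible e form a closed subset of [0,1] that contains 1 by Cauchy-Schwarz,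
   so the least one exists. *)
definition subj_corr :: "'w measure \<Rightarrow> 'w measure \<Rightarrow> 'w measure \<Rightarrow> 'w measure \<Rightarrow> real" where
  "subj_corr M F G H = (LEAST e::real. 0 \<le> e \<and> e \<le> 1 \<and>
     (\<forall>f \<in> sq_integrable M (sigma_join M F H). \<forall>g \<in> sq_integrable M (sigma_join M G H).
        (AE x in M. real_cond_exp M H f x = 0) \<longrightarrow>
        (AE x in M. real_cond_exp M H g x = 0) \<longrightarrow>
        \<bar>\<integral>x. f x * g x \<partial>M\<bar> \<le> e * sd M f * sd M g))"

abbreviation sigma_rv :: "'w measure \<Rightarrow> 'a measure \<Rightarrow> ('w \<Rightarrow> 'a) \<Rightarrow> 'w measure" where
  "sigma_rv M N X \<equiv> vimage_algebra (space M) X N"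

(* S k is the sigma-algebra generated by the k-th variable, so that the variables of the
   family may have values of different types; the join of the S k over K' is the
   sigma-algebra generated by the subfamily K'. *)
definition metalgebra :: "'w measure \<Rightarrow> ('k \<Rightarrow> 'w measure) \<Rightarrow> 'k set \<Rightarrow> 'w measure set" where
  "metalgebra M S K = {sigma (space M) (\<Union>k\<in>K'. sets (S k)) | K'. K' \<subseteq> K}"

definition meta_corr ::
  "'w measure \<Rightarrow> 'w measure \<Rightarrow> 'w measure \<Rightarrow> 'w measure set \<Rightarrow> real" where
  "meta_corr M F G \<M> = (SUP H\<in>\<M>. subj_corr M F G H)"

end

theory Submission
  imports Defs
begin

text \<open>
  Fix a centred square-integrable function \<open>f\<close> of the \<open>X i\<close> with \<open>- n \<le> i < n\<close>, let
  \<open>V a b\<close> be generated by the \<open>X i\<close> with \<open>- n \<le> i < a\<close> and the \<open>Y j\<close> with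
  \<open>- n \<le> j < b\<close>, and decompose \<open>f\<close> into the martingale increments of \<open>V\<close> along a monotone
  lattice path. Along the path that exhausts the \<open>X i\<close> first, all the mass of \<open>f\<close> sits on
  horizontal steps; along the path that exhausts the \<open>Y j\<close> first, the mass on vertical steps contains
  the squared norm of the projection of \<open>f\<close> onto the functions of the \<open>Y j\<close>.

  One path is deformed into the other by flipping unit squares. If the angle between a vector and its
  horizontal component in the square at \<open>(a, b)\<close> is \<open>\<alpha>\<close>, then after the flip its angle is at most
  \<open>\<alpha> + arcsin (\<epsilon> (b - a))\<close>, since the two possible first increments span spaces whose angle has
  cosine at most \<open>\<epsilon> (b - a)\<close>. All squares on a diagonal are flipped at the same time, and a linearized
  form of the angle bound lets one sum over them; thus each diagonal \<open>z\<close> contributes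
  \<open>arcsin (\<epsilon> z)\<close> only once. Letting \<open>n\<close> tend to infinity gives the theorem, because functions
  of finitely many variables are dense.
\<close>

section \<open>Angles and staircase paths\<close>

text \<open>Weighted Cauchy-Schwarz. In a lattice square, \<open>t\<close> and \<open>c\<close> are
  the lengths of a first increment and of its projection to the other neighbour, \<open>p\<close>
  and \<open>q\<close> the lengths of the increments along the other path. The bound is linear in
  the squares of \<open>p\<close> and \<open>q\<close>, hence can be summed over squares; it is
  sharp at \<open>q / p = tan A\<close>, where its right side is \<open>sin (A + \<theta>)\<close>
  squared times the sum of these squares.\<close>

lemma angle_split_bound:
  fixes A \<theta> c p q t :: real
  assumes A: "0 < A" and \<theta>: "0 < \<theta>" and sum: "A + \<theta> \<le> pi / 2"
    and c: "0 \<le> c" "c \<le> sin \<theta> * t" and t: "0 \<le> t" and pq: "0 \<le> p" "0 \<le> q"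
    and le: "t\<^sup>2 \<le> p * c + q * sqrt (t\<^sup>2 - c\<^sup>2)"
  shows "t\<^sup>2 \<le> sin (A + \<theta>) * (sin \<theta> / cos A * p\<^sup>2 + cos \<theta> / sin A * q\<^sup>2)"
proof (cases "t = 0")
  case True
  have "0 \<le> sin (A + \<theta>)" "0 \<le> sin \<theta>" "0 \<le> cos A" "0 \<le> cos \<theta>" "0 \<le> sin A"
    using A \<theta> sum by (auto intro!: sin_ge_zero cos_ge_zero)
  then show ?thesis using True by simp
next
  case False
  \<comment> \<open>With these weights the Cauchy-Schwarz inequality below is an equality for
    \<open>p / q = cot A\<close> and \<open>c / d = tan \<theta>\<close>.\<close>
  define \<alpha> \<beta> d where "\<alpha> = sin \<theta> / cos A" and "\<beta> = cos \<theta> / sin A" and "d = sqrt (t\<^sup>2 - c\<^sup>2)"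
  have pos: "0 < sin \<theta>" "0 < cos A" "0 < cos \<theta>" "0 < sin A" "0 < sin (A + \<theta>)"
    using A \<theta> sum by (auto intro!: sin_gt_zero cos_gt_zero)
  have ct: "c\<^sup>2 \<le> (sin \<theta> * t)\<^sup>2" using c by (intro power_mono)
  also have "\<dots> \<le> t\<^sup>2"
    by (simp add: power_mult_distrib mult_left_le_one_le power_le_one_iff abs_square_le_1)
  finally have d2: "d\<^sup>2 = t\<^sup>2 - c\<^sup>2" unfolding d_def by simp
  have ab: "0 < \<alpha>" "0 < \<beta>" using pos by (auto simp: \<alpha>_def \<beta>_def)
  \<comment> \<open>The weighted sum of the squares of \<open>c\<close> and \<open>d\<close>
    therefore grows with \<open>c\<close>, so that \<open>c = sin \<theta> * t\<close> is the worst
    case. The sign comes from \<open>A + \<theta> \<le> pi / 2\<close>.\<close>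
  have slope: "0 \<le> 1 / \<alpha> - 1 / \<beta>"
  proof -
    have "1 / \<alpha> - 1 / \<beta> = cos (A + \<theta>) / (sin \<theta> * cos \<theta>)"
      using pos by (simp add: \<alpha>_def \<beta>_def cos_add field_simps)
    also have "\<dots> \<ge> 0" using pos A \<theta> sum by (intro divide_nonneg_pos cos_ge_zero) auto
    finally show ?thesis .
  qed
  have "c\<^sup>2 / \<alpha> + d\<^sup>2 / \<beta> = t\<^sup>2 / \<beta> + c\<^sup>2 * (1 / \<alpha> - 1 / \<beta>)"
    using ab by (simp add: d2 field_simps)
  also have "\<dots> \<le> t\<^sup>2 / \<beta> + (sin \<theta> * t)\<^sup>2 * (1 / \<alpha> - 1 / \<beta>)"
    using ct slope by (intro add_left_mono mult_right_mono)
  also have "\<dots> = t\<^sup>2 * ((1 - (sin \<theta>)\<^sup>2) / \<beta> + (sin \<theta>)\<^sup>2 / \<alpha>)"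
    by (simp add: algebra_simps power_mult_distrib diff_divide_distrib)
  also have "1 - (sin \<theta>)\<^sup>2 = (cos \<theta>)\<^sup>2" by (simp add: cos_squared_eq)
  also have "(cos \<theta>)\<^sup>2 / \<beta> + (sin \<theta>)\<^sup>2 / \<alpha> = sin (A + \<theta>)"
    using pos by (simp add: \<alpha>_def \<beta>_def sin_add power2_eq_square)
  finally have cd: "c\<^sup>2 / \<alpha> + d\<^sup>2 / \<beta> \<le> t\<^sup>2 * sin (A + \<theta>)" .
  have "t\<^sup>2 * t\<^sup>2 \<le> (p * c + q * d)\<^sup>2"
    using power_mono[OF le, of 2] by (simp add: d_def power2_eq_square)
  also have "\<dots> \<le> (\<alpha> * p\<^sup>2 + \<beta> * q\<^sup>2) * (c\<^sup>2 / \<alpha> + d\<^sup>2 / \<beta>)"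
  proof -
    have "(\<alpha> * p\<^sup>2 + \<beta> * q\<^sup>2) * (c\<^sup>2 / \<alpha> + d\<^sup>2 / \<beta>) - (p * c + q * d)\<^sup>2
        = (\<alpha> * p * d - \<beta> * q * c)\<^sup>2 / (\<alpha> * \<beta>)"
      using ab by (simp add: field_simps power2_eq_square)
    also have "\<dots> \<ge> 0" using ab by auto
    finally show ?thesis by simp
  qed
  also have "\<dots> \<le> (\<alpha> * p\<^sup>2 + \<beta> * q\<^sup>2) * (t\<^sup>2 * sin (A + \<theta>))"
    using ab by (intro mult_left_mono cd) auto
  finally have "t\<^sup>2 * t\<^sup>2 \<le> t\<^sup>2 * (sin (A + \<theta>) * (\<alpha> * p\<^sup>2 + \<beta> * q\<^sup>2))" by (simp add: ac_simps)
  moreover have "0 < t\<^sup>2" using False by simp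
  ultimately show ?thesis unfolding \<alpha>_def \<beta>_def by (rule mult_left_le_imp_le)
qed

text \<open>
  The staircase of index \<open>k\<close> visits \<open>(a, a + k)\<close>, \<open>(a + 1, a + k)\<close>, \<open>(a + 1, a + k + 1)\<close>, and so on.
  Its step increments of \<open>N\<close> add up to \<open>T\<close>; the share of the vertical ones is kept below
  \<open>(sin A)\<^sup>2 * T\<close>, and replacing all lower right corners by upper left corners, which turns \<open>k\<close>
  into \<open>k + 1\<close>, enlarges \<open>A\<close> by \<open>\<theta> k\<close>. The angles are kept positive so that no
  quotient has denominator 0.
\<close>

lemma staircase_bound:
  fixes N :: "int \<Rightarrow> int \<Rightarrow> real" and \<theta> :: "int \<Rightarrow> real" and T A0 :: real
  assumes mono: "\<And>a b. N a b \<le> N (a + 1) b" "\<And>a b. N a b \<le> N a (b + 1)"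
    and square: "\<And>a b A. \<lbrakk>0 < A; A + \<theta> (b - a) \<le> pi / 2\<rbrakk> \<Longrightarrow>
      N a (b + 1) - N a b \<le> sin (A + \<theta> (b - a)) *
        (sin (\<theta> (b - a)) / cos A * (N (a + 1) b - N a b)
         + cos (\<theta> (b - a)) / sin A * (N (a + 1) (b + 1) - N (a + 1) b))"
    and right: "\<And>a b. int n \<le> a \<Longrightarrow> N a b = T"
    and bottom: "\<And>a b. b \<le> - int n \<Longrightarrow> N a b = N a (- int n)"
    and left: "\<And>a b. a \<le> - int n \<Longrightarrow> N a b = N (- int n) b"
    and corner: "N (- int n) (- int n) = 0"
    and \<theta>: "\<And>z. 0 < \<theta> z" and A0: "0 < A0"
    and total: "A0 + (\<Sum>z\<in>{- 2 * int n..<2 * int n}. \<theta> z) \<le> pi / 2"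
  shows "N (- int n) (int n) \<le> (sin (A0 + (\<Sum>z\<in>{- 2 * int n..<2 * int n}. \<theta> z)))\<^sup>2 * T"
proof -
  \<comment> \<open>The staircase starts at \<open>a = - R\<close>. For
    \<open>\<bar>k\<bar> \<le> 2 * int n\<close> both coordinates are at most \<open>- n\<close>
    there, and the extra 1 keeps this true for the index \<open>k + 1\<close>.\<close>
  define R where "R = 3 * int n + 1"
  define m where "m = nat (2 * R)"
  have m: "int m = 2 * R" by (simp add: m_def R_def)
  \<comment> \<open>In the \<open>j\<close>-th square of the diagonal, \<open>across\<close> belongs
    to the bottom edge, \<open>up\<close> to the right edge and \<open>up'\<close> to the left
    edge.\<close>
  define up where "up k j = N (int j - R + 1) (int j - R + k + 1) - N (int j - R + 1) (int j - R + k)" for k j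
  define across where "across k j = N (int j - R + 1) (int j - R + k) - N (int j - R) (int j - R + k)" for k j
  define up' where "up' k j = N (int j - R) (int j - R + k + 1) - N (int j - R) (int j - R + k)" for k j
  define V where "V k = (\<Sum>j<m. up k j)" for k
  define H where "H k = (\<Sum>j<m. across k j)" for k
  have T0: "0 \<le> T"
  proof -
    have "N (- int n) (- int n) \<le> N (- int n + int j) (- int n)" for j
    proof (induction j)
      case (Suc j)
      then show ?case
        using mono(1)[of "- int n + int j" "- int n"] by (simp add: algebra_simps)
    qed simp
    from this[of "2 * n"] show ?thesis using corner right by simp
  qed
  have HV: "H k + V k = T" if "\<bar>k\<bar> \<le> 2 * int n" for k
  proof -
    have "H k + V k = (\<Sum>j<m. N (int (Suc j) - R) (int (Suc j) - R + k) - N (int j - R) (int j - R + k))"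
      unfolding H_def V_def sum.distrib[symmetric]
      by (intro sum.cong refl) (simp add: up_def across_def algebra_simps)
    also have "\<dots> = N (int m - R) (int m - R + k) - N (int 0 - R) (int 0 - R + k)"
      by (rule sum_lessThan_telescope)
    also have "N (int 0 - R) (int 0 - R + k) = N (- int n) (int 0 - R + k)"
      by (rule left) (simp add: R_def)
    also have "\<dots> = 0"
      using that corner by (subst bottom) (auto simp: R_def)
    also have "N (int m - R) (int m - R + k) = T"
      by (rule right) (simp add: m R_def)
    finally show ?thesis by simp
  qed
  \<comment> \<open>The vertical steps of the staircase \<open>k + 1\<close> are the left edges of
    the squares of the staircase \<open>k\<close>, with the index moved by one. The two boundary
    terms vanish because \<open>N\<close> does not change along the edges at both ends.\<close>
  have shift: "V (k + 1) = (\<Sum>j<m. up' k j)" if "\<bar>k\<bar> \<le> 2 * int n" for k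
  proof -
    have "V (k + 1) = (\<Sum>j<m. up' k (Suc j))"
      unfolding V_def by (intro sum.cong refl) (simp add: up_def up'_def algebra_simps)
    also have "\<dots> = (\<Sum>j<Suc m. up' k j) - up' k 0"
      by (subst sum.lessThan_Suc_shift) simp
    also have "\<dots> = (\<Sum>j<m. up' k j) + up' k m - up' k 0" by simp
    also have "up' k m = 0" unfolding up'_def using right by (simp add: m R_def)
    also have "up' k 0 = 0"
    proof -
      have "N (- R) (k + 1 - R) = N (- R) (- int n)" "N (- R) (k - R) = N (- R) (- int n)"
        using that by (intro bottom; simp add: R_def)+
      then show ?thesis by (simp add: up'_def algebra_simps)
    qed
    finally show ?thesis by simp
  qed
  have step: "V (k + 1) \<le> (sin (A + \<theta> k))\<^sup>2 * T"
    if k: "\<bar>k\<bar> \<le> 2 * int n" and A: "0 < A" "A + \<theta> k \<le> pi / 2" and V: "V k \<le> (sin A)\<^sup>2 * T" for k A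
  proof -
    define s where "s = sin (A + \<theta> k)"
    have pos: "0 < sin (\<theta> k)" "0 < cos A" "0 < sin A" "0 \<le> s" "0 \<le> cos (A + \<theta> k)"
      using A \<theta>[of k] by (auto simp: s_def intro!: sin_gt_zero cos_gt_zero sin_ge_zero cos_ge_zero)
    have "V (k + 1) = (\<Sum>j<m. up' k j)" by (rule shift[OF k])
    also have "\<dots> \<le> (\<Sum>j<m. s * (sin (\<theta> k) / cos A * across k j + cos (\<theta> k) / sin A * up k j))"
    proof (rule sum_mono)
      fix j
      show "up' k j \<le> s * (sin (\<theta> k) / cos A * across k j + cos (\<theta> k) / sin A * up k j)"
        using square[of A "int j - R + k" "int j - R"] A
        by (simp add: up_def up'_def across_def s_def)
    qed
    also have "\<dots> = s * (sin (\<theta> k) / cos A * H k + cos (\<theta> k) / sin A * V k)"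
      by (simp only: H_def V_def sum_distrib_left sum.distrib distrib_left)
    \<comment> \<open>Eliminating \<open>H k\<close> leaves a nonnegative coefficient in front of
      \<open>V k\<close>, so the assumed bound on \<open>V k\<close> can be inserted.\<close>
    also have "H k = T - V k" using HV[OF k] by simp
    also have "sin (\<theta> k) / cos A * (T - V k) + cos (\<theta> k) / sin A * V k
        = sin (\<theta> k) / cos A * T + cos (A + \<theta> k) / (sin A * cos A) * V k"
      using pos by (simp add: cos_add field_simps)
    also have "s * \<dots> \<le> s * (sin (\<theta> k) / cos A * T + cos (A + \<theta> k) / (sin A * cos A) * ((sin A)\<^sup>2 * T))"
      using pos by (intro mult_left_mono add_left_mono V) auto
    also have "sin (\<theta> k) / cos A * T + cos (A + \<theta> k) / (sin A * cos A) * ((sin A)\<^sup>2 * T) = s * T"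
    proof -
      \<comment> \<open>Subtraction formula for \<open>(A + \<theta> k) - A\<close>. Linearizing at
        \<open>A\<close> loses nothing when the vertical share equals its bound.\<close>
      have "sin (\<theta> k) + cos (A + \<theta> k) * sin A = s * cos A"
        using sin_diff[of "A + \<theta> k" A] by (simp add: s_def)
      moreover have "sin (\<theta> k) / cos A * T + cos (A + \<theta> k) / (sin A * cos A) * ((sin A)\<^sup>2 * T)
          = (sin (\<theta> k) + cos (A + \<theta> k) * sin A) / cos A * T"
        using pos by (simp add: field_simps power2_eq_square)
      ultimately show ?thesis using pos by simp
    qed
    finally show ?thesis by (simp add: s_def power2_eq_square)
  qed
  have "V (- 2 * int n + int i) \<le> (sin (A0 + (\<Sum>z\<in>{- 2 * int n..<- 2 * int n + int i}. \<theta> z)))\<^sup>2 * T"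
    if "i \<le> 4 * n" for i
    using that
  proof (induction i)
    case 0
    \<comment> \<open>This staircase passes the window at its lower right: each vertical step has
      either \<open>a \<ge> n\<close>, where \<open>N\<close> is \<open>T\<close>, or both ends at
      \<open>b \<le> - n\<close>.\<close>
    have "up (- 2 * int n) j = 0" for j
    proof (cases "int n \<le> int j - R + 1")
      case True
      then show ?thesis by (simp add: up_def right)
    next
      case False
      then have "N (int j - R + 1) (int j - R + - 2 * int n + 1) = N (int j - R + 1) (- int n)"
        "N (int j - R + 1) (int j - R + - 2 * int n) = N (int j - R + 1) (- int n)"
        by (intro bottom; simp)+
      then show ?thesis by (simp add: up_def)
    qed
    then show ?case using T0 by (simp add: V_def)
  next
    case (Suc i)
    define k A where "k = - 2 * int n + int i" and "A = A0 + (\<Sum>z\<in>{- 2 * int n..<k}. \<theta> z)"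
    have split: "{- 2 * int n..<k + 1} = insert k {- 2 * int n..<k}"
      by (auto simp: k_def)
    have A': "A0 + (\<Sum>z\<in>{- 2 * int n..<k + 1}. \<theta> z) = A + \<theta> k"
      unfolding split by (simp add: A_def)
    have "0 < A" unfolding A_def using A0 \<theta> by (intro add_pos_nonneg sum_nonneg less_imp_le)
    moreover have "A + \<theta> k \<le> pi / 2"
    proof -
      have "(\<Sum>z\<in>{- 2 * int n..<k + 1}. \<theta> z) \<le> (\<Sum>z\<in>{- 2 * int n..<2 * int n}. \<theta> z)"
        using Suc.prems \<theta> by (intro sum_mono2) (auto simp: k_def less_imp_le)
      then show ?thesis using total A' by linarith
    qed
    moreover have "\<bar>k\<bar> \<le> 2 * int n" using Suc.prems by (auto simp: k_def)
    moreover have "V k \<le> (sin A)\<^sup>2 * T" using Suc by (simp add: k_def A_def)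
    ultimately have "V (k + 1) \<le> (sin (A + \<theta> k))\<^sup>2 * T" by (intro step)
    then show ?case unfolding A'[symmetric] by (simp add: k_def algebra_simps)
  qed
  from this[of "4 * n"]
  have "V (2 * int n) \<le> (sin (A0 + (\<Sum>z\<in>{- 2 * int n..<2 * int n}. \<theta> z)))\<^sup>2 * T" by simp
  \<comment> \<open>The staircase of index \<open>2 * n\<close> passes the window at its upper left.
    Its first \<open>R - n\<close> vertical steps have \<open>a \<le> - n\<close> and end at
    \<open>b = n\<close>, so they telescope to \<open>N (- n) n\<close>; the other ones are
    nonnegative.\<close>
  moreover have "N (- int n) (int n) \<le> V (2 * int n)"
  proof -
    define l where "l = nat (R - int n)"
    have l: "int l = R - int n" by (simp add: l_def R_def)
    have "(\<Sum>j<l. up (2 * int n) j)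
        = (\<Sum>j<l. N (- int n) (int (Suc j) - R + 2 * int n) - N (- int n) (int j - R + 2 * int n))"
    proof (intro sum.cong refl)
      fix j assume "j \<in> {..<l}"
      then have "N (int j - R + 1) b = N (- int n) b" for b
        using l by (intro left) auto
      then show "up (2 * int n) j
          = N (- int n) (int (Suc j) - R + 2 * int n) - N (- int n) (int j - R + 2 * int n)"
        by (simp add: up_def algebra_simps)
    qed
    also have "\<dots> = N (- int n) (int l - R + 2 * int n) - N (- int n) (int 0 - R + 2 * int n)"
      by (rule sum_lessThan_telescope)
    also have "N (- int n) (int 0 - R + 2 * int n) = 0"
      using corner by (subst bottom) (auto simp: R_def)
    finally have "N (- int n) (int n) = (\<Sum>j<l. up (2 * int n) j)" by (simp add: l)
    also have "\<dots> \<le> V (2 * int n)"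
      unfolding V_def using m l mono(2)[of "int j - R + 1" "int j - R + 2 * int n" for j]
      by (intro sum_mono2) (auto simp: up_def R_def)
    finally show ?thesis .
  qed
  ultimately show ?thesis by linarith
qed

section \<open>Projections of square-integrable functions\<close>

lemma sq_integrable_measurable: "f \<in> sq_integrable M F \<Longrightarrow> f \<in> borel_measurable F"
  by (simp add: sq_integrable_def)

lemma sq_integrable_square: "f \<in> sq_integrable M F \<Longrightarrow> integrable M (\<lambda>x. (f x)\<^sup>2)"
  by (simp add: sq_integrable_def)

lemma sq_integrable_mono:
  assumes "f \<in> sq_integrable M F" "subalgebra G F"
  shows "f \<in> sq_integrable M G"
  using assms measurable_from_subalg by (auto simp: sq_integrable_def)

lemma integrable_times:
  assumes f: "f \<in> sq_integrable M M" and g: "g \<in> sq_integrable M M"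
  shows "integrable M (\<lambda>x. f x * g x)"
proof (rule Bochner_Integration.integrable_bound)
  show "integrable M (\<lambda>x. (f x)\<^sup>2 + (g x)\<^sup>2)"
    using f g by (intro Bochner_Integration.integrable_add sq_integrable_square)
  show "(\<lambda>x. f x * g x) \<in> borel_measurable M"
    using f g by (auto dest!: sq_integrable_measurable)
  have "\<bar>f x * g x\<bar> \<le> (f x)\<^sup>2 + (g x)\<^sup>2" for x
  proof -
    have "2 * (\<bar>f x\<bar> * \<bar>g x\<bar>) \<le> (f x)\<^sup>2 + (g x)\<^sup>2"
      using sum_squares_bound[of "\<bar>f x\<bar>" "\<bar>g x\<bar>"] by simp
    moreover have "0 \<le> \<bar>f x\<bar> * \<bar>g x\<bar>" by simp
    ultimately show ?thesis unfolding abs_mult by linarith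
  qed
  then show "AE x in M. norm (f x * g x) \<le> norm ((f x)\<^sup>2 + (g x)\<^sup>2)" by simp
qed

lemma sq_integrable_add:
  assumes f: "f \<in> sq_integrable M F" and g: "g \<in> sq_integrable M F" and F: "subalgebra M F"
  shows "(\<lambda>x. f x + g x) \<in> sq_integrable M F"
proof -
  have "integrable M (\<lambda>x. (f x)\<^sup>2 + (g x)\<^sup>2 + 2 * (f x * g x))"
    using f g sq_integrable_mono[OF f F] sq_integrable_mono[OF g F]
    by (intro Bochner_Integration.integrable_add Bochner_Integration.integrable_mult_right
        integrable_times sq_integrable_square)
  then have "integrable M (\<lambda>x. (f x + g x)\<^sup>2)" by (simp add: power2_sum algebra_simps)
  then show ?thesis
    using f[THEN sq_integrable_measurable] g[THEN sq_integrable_measurable]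
    by (simp add: sq_integrable_def)
qed

lemma sq_integrable_cmult:
  assumes "f \<in> sq_integrable M F"
  shows "(\<lambda>x. c * f x) \<in> sq_integrable M F"
  using assms by (auto simp: sq_integrable_def power_mult_distrib)

lemma sq_integrable_diff:
  assumes f: "f \<in> sq_integrable M F" and g: "g \<in> sq_integrable M F" and F: "subalgebra M F"
  shows "(\<lambda>x. f x - g x) \<in> sq_integrable M F"
  using sq_integrable_add[OF f sq_integrable_cmult[OF g, of "-1"] F] by simp

lemma subalgebra_refl: "subalgebra M M" by (simp add: subalgebra_def)

lemma subalgebra_trans: "subalgebra M F \<Longrightarrow> subalgebra F G \<Longrightarrow> subalgebra M G"
  by (auto simp: subalgebra_def)

lemma Cauchy_Schwarz_integral:
  assumes f: "f \<in> sq_integrable M M" and g: "g \<in> sq_integrable M M"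
  shows "\<bar>\<integral>x. f x * g x \<partial>M\<bar> \<le> sqrt (\<integral>x. (f x)\<^sup>2 \<partial>M) * sqrt (\<integral>x. (g x)\<^sup>2 \<partial>M)"
proof -
  define a b c where "a = (\<integral>x. (f x)\<^sup>2 \<partial>M)" and "b = (\<integral>x. f x * g x \<partial>M)" and "c = (\<integral>x. (g x)\<^sup>2 \<partial>M)"
  have ge: "0 \<le> a" "0 \<le> c" by (auto simp: a_def c_def)
  have quad: "0 \<le> a * s\<^sup>2 + c * t\<^sup>2 - 2 * b * s * t" for s t
  proof -
    have "0 \<le> (\<integral>x. (s * f x - t * g x)\<^sup>2 \<partial>M)" by simp
    also have "\<dots> = (\<integral>x. s\<^sup>2 * (f x)\<^sup>2 + t\<^sup>2 * (g x)\<^sup>2 - 2 * s * t * (f x * g x) \<partial>M)"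
      by (intro Bochner_Integration.integral_cong refl) (simp add: power2_diff algebra_simps)
    also have "\<dots> = a * s\<^sup>2 + c * t\<^sup>2 - 2 * b * s * t"
      using f g sq_integrable_square[OF f] sq_integrable_square[OF g] integrable_times[OF f g]
      by (simp add: a_def b_def c_def)
    finally show ?thesis .
  qed
  have "b\<^sup>2 \<le> a * c"
  proof (cases "a = 0")
    case True
    have "b = 0"
    proof (rule ccontr)
      assume "b \<noteq> 0"
      \<comment> \<open>At this point the quadratic form would have the value -1.\<close>
      then show False using quad[of "(c + 1) / (2 * b)" 1] True by simp
    qed
    then show ?thesis using True by simp
  next
    case False
    have "0 \<le> a * (a * c - b\<^sup>2)" using quad[of b a] by (simp add: algebra_simps power2_eq_square)
    then show ?thesis using False ge by (simp add: zero_le_mult_iff)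
  qed
  then have "\<bar>b\<bar> \<le> sqrt (a * c)" using real_sqrt_le_mono[of "b\<^sup>2"] by simp
  then show ?thesis by (simp add: a_def b_def c_def real_sqrt_mult)
qed

section \<open>Conditional expectation as orthogonal projection\<close>

lemma (in prob_space) integrable_sq_integrable:
  "f \<in> sq_integrable M M \<Longrightarrow> integrable M f"
  by (rule square_integrable_imp_integrable) (auto simp: sq_integrable_def)

lemma (in prob_space) sq_integrable_const: "(\<lambda>x. c) \<in> sq_integrable M F"
  by (simp add: sq_integrable_def)

lemma (in prob_space) subalgebra_sigma_finite:
  "subalgebra M F \<Longrightarrow> sigma_finite_subalgebra M F"
  by (intro finite_measure_subalgebra_is_sigma_finite finite_measure_subalgebra.intro
      finite_measure_subalgebra_axioms.intro finite_measure_axioms)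

text \<open>Conditional Jensen inequality for the square.\<close>

lemma (in prob_space) cond_exp_sq_integrable:
  assumes F: "subalgebra M F" and f: "f \<in> sq_integrable M M"
  shows "real_cond_exp M F f \<in> sq_integrable M F"
proof -
  interpret S: sigma_finite_subalgebra M F by (rule subalgebra_sigma_finite[OF F])
  have "integrable M (\<lambda>x. (real_cond_exp M F f x)\<^sup>2)"
    using f by (intro S.integrable_convex_cond_exp[where I = UNIV and q = power2] convex_power2
        integrable_sq_integrable sq_integrable_square) auto
  then show ?thesis by (simp add: sq_integrable_def)
qed

lemma (in prob_space) integral_times_cond_exp:
  assumes F: "subalgebra M F" and f: "f \<in> sq_integrable M F" and g: "g \<in> sq_integrable M M"
  shows "(\<integral>x. f x * real_cond_exp M F g x \<partial>M) = (\<integral>x. f x * g x \<partial>M)"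
proof -
  interpret S: sigma_finite_subalgebra M F by (rule subalgebra_sigma_finite[OF F])
  show ?thesis
    using sq_integrable_mono[OF f F] f g
    by (intro S.real_cond_exp_intg(2) integrable_times) (auto dest: sq_integrable_measurable)
qed

text \<open>On the lattice this becomes the function \<open>N\<close> of
  \<open>staircase_bound\<close>: by Pythagoras its increments are the squared lengths of the
  martingale increments of \<open>f\<close>, so they add up along every monotone path.\<close>

definition proj_sqnorm :: "'w measure \<Rightarrow> ('w \<Rightarrow> real) \<Rightarrow> 'w measure \<Rightarrow> real" where
  "proj_sqnorm M f F = (\<integral>x. (real_cond_exp M F f x)\<^sup>2 \<partial>M)"

text \<open>The projection to \<open>F\<close> is also measurable for \<open>G\<close>. Hence the
  projection to \<open>G\<close> can be replaced by \<open>f\<close>, and then \<open>f\<close> by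
  its projection to \<open>F\<close>.\<close>

lemma (in prob_space) integral_cond_exp_times_nested:
  assumes G: "subalgebra M G" and F: "subalgebra G F" and f: "f \<in> sq_integrable M M"
  shows "(\<integral>x. real_cond_exp M F f x * real_cond_exp M G f x \<partial>M) = proj_sqnorm M f F"
proof -
  have F': "subalgebra M F" by (rule subalgebra_trans[OF G F])
  note PF = cond_exp_sq_integrable[OF F' f]
  have "(\<integral>x. real_cond_exp M F f x * real_cond_exp M G f x \<partial>M) = (\<integral>x. real_cond_exp M F f x * f x \<partial>M)"
    by (rule integral_times_cond_exp[OF G sq_integrable_mono[OF PF F] f])
  also have "\<dots> = (\<integral>x. real_cond_exp M F f x * real_cond_exp M F f x \<partial>M)"
    by (rule integral_times_cond_exp[OF F' PF f, symmetric])
  finally show ?thesis by (simp add: proj_sqnorm_def power2_eq_square)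
qed

lemma integral_square_diff:
  assumes f: "f \<in> sq_integrable M M" and g: "g \<in> sq_integrable M M"
  shows "(\<integral>x. (f x - g x)\<^sup>2 \<partial>M) = (\<integral>x. (f x)\<^sup>2 \<partial>M) - 2 * (\<integral>x. f x * g x \<partial>M) + (\<integral>x. (g x)\<^sup>2 \<partial>M)"
proof -
  have "(\<integral>x. (f x - g x)\<^sup>2 \<partial>M) = (\<integral>x. (f x)\<^sup>2 - 2 * (f x * g x) + (g x)\<^sup>2 \<partial>M)"
    by (intro Bochner_Integration.integral_cong refl) (simp add: power2_diff)
  then show ?thesis
    using sq_integrable_square[OF f] sq_integrable_square[OF g] integrable_times[OF f g] by simp
qed

text \<open>Pythagoras: the cross term of the expanded square is the squared norm of the smaller
  projection.\<close>

lemma (in prob_space) integral_square_cond_exp_diff: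
  assumes G: "subalgebra M G" and F: "subalgebra G F" and f: "f \<in> sq_integrable M M"
  shows "(\<integral>x. (real_cond_exp M G f x - real_cond_exp M F f x)\<^sup>2 \<partial>M)
    = proj_sqnorm M f G - proj_sqnorm M f F"
proof -
  have F': "subalgebra M F" by (rule subalgebra_trans[OF G F])
  have "(\<integral>x. real_cond_exp M G f x * real_cond_exp M F f x \<partial>M) = proj_sqnorm M f F"
    using integral_cond_exp_times_nested[OF G F f] by (simp add: mult.commute)
  then show ?thesis
    using sq_integrable_mono[OF cond_exp_sq_integrable[OF G f] G]
      sq_integrable_mono[OF cond_exp_sq_integrable[OF F' f] F']
    by (simp add: integral_square_diff proj_sqnorm_def)
qed

lemma (in prob_space) proj_sqnorm_mono:
  assumes "subalgebra M G" "subalgebra G F" "f \<in> sq_integrable M M"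
  shows "proj_sqnorm M f F \<le> proj_sqnorm M f G"
proof -
  have "0 \<le> (\<integral>x. (real_cond_exp M G f x - real_cond_exp M F f x)\<^sup>2 \<partial>M)" by simp
  then show ?thesis by (simp add: integral_square_cond_exp_diff[OF assms])
qed

lemma (in prob_space) proj_sqnorm_measurable:
  assumes F: "subalgebra M F" and f: "f \<in> sq_integrable M F"
  shows "proj_sqnorm M f F = (\<integral>x. (f x)\<^sup>2 \<partial>M)"
proof -
  interpret S: sigma_finite_subalgebra M F by (rule subalgebra_sigma_finite[OF F])
  have "AE x in M. real_cond_exp M F f x = f x"
    using f integrable_sq_integrable[OF sq_integrable_mono[OF f F]]
    by (intro S.real_cond_exp_F_meas) (auto dest: sq_integrable_measurable)
  moreover have "f \<in> borel_measurable M"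
    using sq_integrable_mono[OF f F] by (rule sq_integrable_measurable)
  ultimately show ?thesis unfolding proj_sqnorm_def by (intro integral_cong_AE) auto
qed

section \<open>Conditional correlation and a single lattice square\<close>

lemma (in prob_space) sd_centred:
  "expectation f = 0 \<Longrightarrow> sd M f = sqrt (\<integral>x. (f x)\<^sup>2 \<partial>M)"
  by (simp add: sd_def)

text \<open>The inequality inside \<open>subj_corr\<close> without the range condition on
  \<open>e\<close>, and with \<open>F\<close> and \<open>G\<close> in the place of the joins with
  \<open>H\<close>. In this form it speaks directly of the corners of a lattice square.\<close>

definition cond_corr_le :: "'w measure \<Rightarrow> 'w measure \<Rightarrow> 'w measure \<Rightarrow> 'w measure \<Rightarrow> real \<Rightarrow> bool" where
  "cond_corr_le M F G H e \<longleftrightarrow>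
    (\<forall>f \<in> sq_integrable M F. \<forall>g \<in> sq_integrable M G.
       (AE x in M. real_cond_exp M H f x = 0) \<longrightarrow> (AE x in M. real_cond_exp M H g x = 0) \<longrightarrow>
       \<bar>\<integral>x. f x * g x \<partial>M\<bar> \<le> e * sd M f * sd M g)"

lemma (in prob_space) expectation_cond_exp_zero:
  assumes H: "subalgebra M H" and f: "integrable M f" and 0: "AE x in M. real_cond_exp M H f x = 0"
  shows "expectation f = 0"
proof -
  interpret S: sigma_finite_subalgebra M H by (rule subalgebra_sigma_finite[OF H])
  have "expectation f = expectation (real_cond_exp M H f)" using S.real_cond_exp_int(2)[OF f] by simp
  also have "\<dots> = expectation (\<lambda>_. 0)" using 0 by (intro integral_cong_AE) auto
  finally show ?thesis by simp
qed

text \<open>The square has lower left corner \<open>H\<close>, neighbours \<open>F\<close> and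
  \<open>G\<close>, and upper right corner \<open>D\<close>. The increment from \<open>H\<close> to
  \<open>G\<close> is split into its projection to \<open>F\<close> and the rest: the first part
  meets only the increment from \<open>H\<close> to \<open>F\<close>, the rest only that from
  \<open>F\<close> to \<open>D\<close>. The correlation hypothesis bounds the first part, and
  \<open>angle_split_bound\<close> concludes.\<close>

lemma (in prob_space) proj_sqnorm_square_bound:
  assumes D: "subalgebra M D" and DF: "subalgebra D F" and DG: "subalgebra D G"
    and FH: "subalgebra F H" and GH: "subalgebra G H"
    and f: "f \<in> sq_integrable M M"
    and corr: "cond_corr_le M F G H (sin \<theta>)"
    and A: "0 < A" and \<theta>: "0 < \<theta>" and sum: "A + \<theta> \<le> pi / 2"
  shows "proj_sqnorm M f G - proj_sqnorm M f H \<le> sin (A + \<theta>) *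
    (sin \<theta> / cos A * (proj_sqnorm M f F - proj_sqnorm M f H)
     + cos \<theta> / sin A * (proj_sqnorm M f D - proj_sqnorm M f F))"
proof -
  have F: "subalgebra M F" and G: "subalgebra M G" and H: "subalgebra M H" and DH: "subalgebra D H"
    using D DF DG FH unfolding subalgebra_def by blast+
  interpret SH: sigma_finite_subalgebra M H by (rule subalgebra_sigma_finite[OF H])
  have L2M: "\<And>h. h \<in> sq_integrable M F \<Longrightarrow> h \<in> sq_integrable M M"
    "\<And>h. h \<in> sq_integrable M G \<Longrightarrow> h \<in> sq_integrable M M"
    by (auto intro: sq_integrable_mono[OF _ F] sq_integrable_mono[OF _ G])
  let ?P = "\<lambda>Q. real_cond_exp M Q f"
  define e u1 u2 where "e x = ?P G x - ?P H x" and "u1 x = ?P F x - ?P H x"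
    and "u2 x = ?P D x - ?P F x" for x
  define w where "w = real_cond_exp M F e"
  have P: "?P F \<in> sq_integrable M F" "?P G \<in> sq_integrable M G" "?P H \<in> sq_integrable M H"
    "?P D \<in> sq_integrable M D"
    using F G H D f by (auto intro: cond_exp_sq_integrable)
  have PM: "?P F \<in> sq_integrable M M" "?P G \<in> sq_integrable M M" "?P H \<in> sq_integrable M M"
    "?P D \<in> sq_integrable M M"
    by (fact sq_integrable_mono[OF P(1) F] sq_integrable_mono[OF P(2) G]
        sq_integrable_mono[OF P(3) H] sq_integrable_mono[OF P(4) D])+
  have e: "e \<in> sq_integrable M G" unfolding e_def using P GH G
    by (intro sq_integrable_diff) (auto intro: sq_integrable_mono[OF P(3)])
  have eM: "e \<in> sq_integrable M M" by (rule L2M(2)[OF e])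
  have u1: "u1 \<in> sq_integrable M F" unfolding u1_def using P FH F
    by (intro sq_integrable_diff) (auto intro: sq_integrable_mono[OF P(3)])
  have u2: "u2 \<in> sq_integrable M M" unfolding u2_def
    using PM by (auto intro: sq_integrable_diff subalgebra_refl)
  have w: "w \<in> sq_integrable M F" unfolding w_def by (rule cond_exp_sq_integrable[OF F eM])
  have wM: "w \<in> sq_integrable M M" by (rule L2M(1)[OF w])
  \<comment> \<open>The correlation hypothesis will be applied to \<open>w\<close> and
    \<open>e\<close>, so both must be centred given \<open>H\<close>; for \<open>w\<close> this is
    the tower property.\<close>
  have HeM: "AE x in M. real_cond_exp M H e x = 0"
  proof -
    have "AE x in M. real_cond_exp M H e x = real_cond_exp M H (?P G) x - real_cond_exp M H (?P H) x"
      unfolding e_def using P PM by (intro SH.real_cond_exp_diff integrable_sq_integrable)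
    moreover have "AE x in M. real_cond_exp M H (?P G) x = ?P H x"
      using f by (intro SH.real_cond_exp_nested_subalg G GH integrable_sq_integrable)
    moreover have "AE x in M. real_cond_exp M H (?P H) x = ?P H x"
      using P PM by (intro SH.real_cond_exp_F_meas integrable_sq_integrable)
        (auto dest: sq_integrable_measurable)
    ultimately show ?thesis by eventually_elim simp
  qed
  have Hw: "AE x in M. real_cond_exp M H w x = 0"
  proof -
    have "AE x in M. real_cond_exp M H w x = real_cond_exp M H e x"
      unfolding w_def using eM by (intro SH.real_cond_exp_nested_subalg F FH integrable_sq_integrable)
    then show ?thesis using HeM by eventually_elim simp
  qed
  define c t p q where "c = sqrt (\<integral>x. (w x)\<^sup>2 \<partial>M)" and "t = sqrt (\<integral>x. (e x)\<^sup>2 \<partial>M)"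
    and "p = sqrt (\<integral>x. (u1 x)\<^sup>2 \<partial>M)" and "q = sqrt (\<integral>x. (u2 x)\<^sup>2 \<partial>M)"
  have t2: "t\<^sup>2 = proj_sqnorm M f G - proj_sqnorm M f H"
    using integral_square_cond_exp_diff[OF G GH f] proj_sqnorm_mono[OF G GH f] by (simp add: t_def e_def)
  have p2: "p\<^sup>2 = proj_sqnorm M f F - proj_sqnorm M f H"
    using integral_square_cond_exp_diff[OF F FH f] proj_sqnorm_mono[OF F FH f] by (simp add: p_def u1_def)
  have q2: "q\<^sup>2 = proj_sqnorm M f D - proj_sqnorm M f F"
    using integral_square_cond_exp_diff[OF D DF f] proj_sqnorm_mono[OF D DF f] by (simp add: q_def u2_def)
  have we: "(\<integral>x. w x * e x \<partial>M) = c\<^sup>2"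
    
  proof -
    have "(\<integral>x. w x * e x \<partial>M) = (\<integral>x. w x * w x \<partial>M)"
      using integral_times_cond_exp[OF F w eM] by (simp add: w_def)
    then show ?thesis by (simp add: c_def flip: power2_eq_square)
  qed
  have u1e: "(\<integral>x. u1 x * e x \<partial>M) = (\<integral>x. u1 x * w x \<partial>M)"
    using integral_times_cond_exp[OF F u1 eM] by (simp add: w_def)
  \<comment> \<open>The increment \<open>u2\<close> is orthogonal to all square-integrable functions
    of \<open>F\<close>.\<close>
  have u2w: "(\<integral>x. u2 x * w x \<partial>M) = 0"
  proof -
    have "(\<integral>x. w x * ?P D x \<partial>M) = (\<integral>x. w x * f x \<partial>M)"
      by (rule integral_times_cond_exp[OF D sq_integrable_mono[OF w DF] f])
    moreover have "(\<integral>x. w x * ?P F x \<partial>M) = (\<integral>x. w x * f x \<partial>M)"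
      by (rule integral_times_cond_exp[OF F w f])
    moreover have "(\<integral>x. u2 x * w x \<partial>M) = (\<integral>x. w x * ?P D x - w x * ?P F x \<partial>M)"
      by (simp add: u2_def algebra_simps)
    moreover have "\<dots> = (\<integral>x. w x * ?P D x \<partial>M) - (\<integral>x. w x * ?P F x \<partial>M)"
      using wM PM by (intro Bochner_Integration.integral_diff integrable_times) auto
    ultimately show ?thesis by simp
  qed
  \<comment> \<open>The inner product of \<open>e\<close> with its own projection \<open>w\<close>
    is the square of \<open>c\<close>, so one factor \<open>c\<close> cancels.\<close>
  have c_le: "c \<le> sin \<theta> * t"
  proof (cases "c = 0")
    case True
    then show ?thesis using \<theta> sum A by (auto simp: t_def intro!: mult_nonneg_nonneg sin_ge_zero)
  next
    case False
    have "c\<^sup>2 \<le> \<bar>\<integral>x. w x * e x \<partial>M\<bar>" using we by simp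
    also have "\<dots> \<le> sin \<theta> * sd M w * sd M e"
      using corr w e Hw HeM unfolding cond_corr_le_def by auto
    also have "sd M w = c" unfolding c_def
      by (intro sd_centred expectation_cond_exp_zero[OF H _ Hw] integrable_sq_integrable wM)
    also have "sd M e = t" unfolding t_def
      by (intro sd_centred expectation_cond_exp_zero[OF H _ HeM] integrable_sq_integrable eM)
    finally have "c * c \<le> c * (sin \<theta> * t)" by (simp add: power2_eq_square ac_simps)
    moreover have "0 < c" using False by (simp add: c_def order_less_le)
    ultimately show ?thesis by (rule mult_left_le_imp_le)
  qed
  have "t\<^sup>2 = (\<integral>x. u1 x * w x \<partial>M) + (\<integral>x. u2 x * (e x - w x) \<partial>M)"
  proof -
    \<comment> \<open>Here \<open>u1 + u2\<close> is the increment of \<open>f\<close> from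
      \<open>H\<close> to \<open>D\<close>, and its projection to \<open>G\<close> is
      \<open>e\<close>; hence its inner product with \<open>e\<close> is the square of
      \<open>t\<close>.\<close>
    have "(\<integral>x. ?P G x * ?P D x \<partial>M) = proj_sqnorm M f G" "(\<integral>x. ?P H x * ?P D x \<partial>M) = proj_sqnorm M f H"
      "(\<integral>x. ?P H x * ?P G x \<partial>M) = proj_sqnorm M f H"
      using integral_cond_exp_times_nested f D DG DH G GH by auto
    moreover have "(\<integral>x. u1 x * e x + u2 x * e x \<partial>M)
        = (\<integral>x. ?P G x * ?P D x - ?P H x * ?P D x - (?P H x * ?P G x - (?P H x)\<^sup>2) \<partial>M)"
      by (intro Bochner_Integration.integral_cong refl) (unfold u1_def u2_def e_def, algebra)
    moreover have "\<dots> = (\<integral>x. ?P G x * ?P D x \<partial>M) - (\<integral>x. ?P H x * ?P D x \<partial>M)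
        - ((\<integral>x. ?P H x * ?P G x \<partial>M) - (\<integral>x. (?P H x)\<^sup>2 \<partial>M))"
      using PM by (simp add: integrable_times sq_integrable_square)
    ultimately have "t\<^sup>2 = (\<integral>x. u1 x * e x + u2 x * e x \<partial>M)"
      by (simp add: t2 proj_sqnorm_def)
    also have "\<dots> = (\<integral>x. u1 x * e x \<partial>M) + (\<integral>x. u2 x * e x \<partial>M)"
      using u1 u2 eM L2M by (intro Bochner_Integration.integral_add integrable_times) auto
    also have "(\<integral>x. u2 x * e x \<partial>M) = (\<integral>x. u2 x * e x - u2 x * w x \<partial>M)"
      using u2 eM wM u2w by (simp add: integrable_times)
    finally show ?thesis by (simp add: u1e right_diff_distrib)
  qed
  also have "(\<integral>x. u1 x * w x \<partial>M) \<le> p * c"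
    using Cauchy_Schwarz_integral[OF L2M(1)[OF u1] wM] by (simp add: p_def c_def)
  also have "(\<integral>x. u2 x * (e x - w x) \<partial>M) \<le> q * sqrt (\<integral>x. (e x - w x)\<^sup>2 \<partial>M)"
    using Cauchy_Schwarz_integral[OF u2 sq_integrable_diff[OF eM wM subalgebra_refl]]
    by (simp add: q_def)
  also have "(\<integral>x. (e x - w x)\<^sup>2 \<partial>M) = t\<^sup>2 - c\<^sup>2"
    using we by (simp add: integral_square_diff[OF eM wM] mult.commute c_def t_def)
  finally have "t\<^sup>2 \<le> p * c + q * sqrt (t\<^sup>2 - c\<^sup>2)" by simp
  then have "t\<^sup>2 \<le> sin (A + \<theta>) * (sin \<theta> / cos A * p\<^sup>2 + cos \<theta> / sin A * q\<^sup>2)"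
    by (intro angle_split_bound[OF A \<theta> sum _ c_le]) (simp_all add: c_def t_def p_def q_def)
  then show ?thesis by (simp add: t2 p2 q2)
qed

section \<open>Density along increasing subalgebras\<close>

text \<open>The closure in L2 of the union of the spaces of square-integrable functions of the
  \<open>F n\<close>.\<close>

definition L2_approximable :: "'w measure \<Rightarrow> (nat \<Rightarrow> 'w measure) \<Rightarrow> ('w \<Rightarrow> real) \<Rightarrow> bool" where
  "L2_approximable M F f \<longleftrightarrow> f \<in> sq_integrable M M \<and>
     (\<forall>e>0. \<exists>n. \<exists>h\<in>sq_integrable M (F n). (\<integral>x. (f x - h x)\<^sup>2 \<partial>M) < e)"

text \<open>Plays the part of the triangle inequality for squared norms: two errors below
  \<open>e / 4\<close> give a total below \<open>e\<close>.\<close>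

lemma integral_square_add_le:
  assumes f: "f \<in> sq_integrable M M" and g: "g \<in> sq_integrable M M"
  shows "(\<integral>x. (f x + g x)\<^sup>2 \<partial>M) \<le> 2 * (\<integral>x. (f x)\<^sup>2 \<partial>M) + 2 * (\<integral>x. (g x)\<^sup>2 \<partial>M)"
proof -
  note int = sq_integrable_square[OF f] sq_integrable_square[OF g]
    sq_integrable_square[OF sq_integrable_add[OF f g subalgebra_refl]]
  have "(f x + g x)\<^sup>2 \<le> 2 * (f x)\<^sup>2 + 2 * (g x)\<^sup>2" for x
    using sum_squares_bound[of "f x" "g x"] by (simp add: power2_sum)
  then have "(\<integral>x. (f x + g x)\<^sup>2 \<partial>M) \<le> (\<integral>x. 2 * (f x)\<^sup>2 + 2 * (g x)\<^sup>2 \<partial>M)"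
    using int by (intro integral_mono) auto
  then show ?thesis using int by simp
qed

locale subalgebra_chain = prob_space M for M :: "'w measure" +
  fixes F :: "nat \<Rightarrow> 'w measure"
  assumes sub: "\<And>n. subalgebra M (F n)"
    and chain: "\<And>m n. m \<le> n \<Longrightarrow> subalgebra (F n) (F m)"
begin

lemma L2_approximable_limit:
  assumes f: "f \<in> sq_integrable M M"
    and lim: "\<And>e. 0 < e \<Longrightarrow> \<exists>g. L2_approximable M F g \<and> (\<integral>x. (f x - g x)\<^sup>2 \<partial>M) < e"
  shows "L2_approximable M F f"
  unfolding L2_approximable_def
proof (intro conjI f allI impI)
  fix e :: real assume "0 < e"
  then obtain g where g: "L2_approximable M F g" and fg: "(\<integral>x. (f x - g x)\<^sup>2 \<partial>M) < e / 4"
    using lim[of "e / 4"] by auto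
  obtain n h where h: "h \<in> sq_integrable M (F n)" and gh: "(\<integral>x. (g x - h x)\<^sup>2 \<partial>M) < e / 4"
    using g \<open>0 < e\<close> unfolding L2_approximable_def by (meson divide_pos_pos zero_less_numeral)
  have gM: "g \<in> sq_integrable M M" using g by (simp add: L2_approximable_def)
  have hM: "h \<in> sq_integrable M M" by (rule sq_integrable_mono[OF h sub])
  have "(\<integral>x. (f x - h x)\<^sup>2 \<partial>M) < e"
    using integral_square_add_le[OF sq_integrable_diff[OF f gM subalgebra_refl]
        sq_integrable_diff[OF gM hM subalgebra_refl]] fg gh by simp
  then show "\<exists>n. \<exists>h\<in>sq_integrable M (F n). (\<integral>x. (f x - h x)\<^sup>2 \<partial>M) < e" using h by blast
qed

lemma L2_approximable_member:
  assumes "f \<in> sq_integrable M (F n)"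
  shows "L2_approximable M F f"
  unfolding L2_approximable_def
proof (intro conjI allI impI)
  show "f \<in> sq_integrable M M" by (rule sq_integrable_mono[OF assms sub])
  show "\<exists>n. \<exists>h\<in>sq_integrable M (F n). (\<integral>x. (f x - h x)\<^sup>2 \<partial>M) < e" if "0 < e" for e :: real
    using assms that by (intro exI[of _ n] bexI[of _ f]) auto
qed

lemma L2_approximable_add:
  assumes f: "L2_approximable M F f" and g: "L2_approximable M F g"
  shows "L2_approximable M F (\<lambda>x. f x + g x)"
proof (rule L2_approximable_limit)
  have fM: "f \<in> sq_integrable M M" and gM: "g \<in> sq_integrable M M"
    using f g by (auto simp: L2_approximable_def)
  show "(\<lambda>x. f x + g x) \<in> sq_integrable M M"
    by (rule sq_integrable_add[OF fM gM subalgebra_refl])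
  fix e :: real assume e: "0 < e"
  obtain m h where h: "h \<in> sq_integrable M (F m)" and fh: "(\<integral>x. (f x - h x)\<^sup>2 \<partial>M) < e / 4"
    using f e unfolding L2_approximable_def by (meson divide_pos_pos zero_less_numeral)
  obtain n k where k: "k \<in> sq_integrable M (F n)" and gk: "(\<integral>x. (g x - k x)\<^sup>2 \<partial>M) < e / 4"
    using g e unfolding L2_approximable_def by (meson divide_pos_pos zero_less_numeral)
  have h': "h \<in> sq_integrable M (F (max m n))" and k': "k \<in> sq_integrable M (F (max m n))"
    using sq_integrable_mono[OF h chain] sq_integrable_mono[OF k chain] by auto
  have hM: "h \<in> sq_integrable M M" and kM: "k \<in> sq_integrable M M"
    by (rule sq_integrable_mono[OF h sub] sq_integrable_mono[OF k sub])+
  have "(\<integral>x. (f x + g x - (h x + k x))\<^sup>2 \<partial>M) < e"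
    using integral_square_add_le[OF sq_integrable_diff[OF fM hM subalgebra_refl]
        sq_integrable_diff[OF gM kM subalgebra_refl]] fh gk by (simp add: algebra_simps)
  then show "\<exists>l. L2_approximable M F l \<and> (\<integral>x. (f x + g x - l x)\<^sup>2 \<partial>M) < e"
    using L2_approximable_member[OF sq_integrable_add[OF h' k' sub]] by blast
qed

lemma L2_approximable_cmult:
  assumes f: "L2_approximable M F f"
  shows "L2_approximable M F (\<lambda>x. c * f x)"
proof (rule L2_approximable_limit)
  show "(\<lambda>x. c * f x) \<in> sq_integrable M M"
    using f by (auto simp: L2_approximable_def intro: sq_integrable_cmult)
  fix e :: real assume e: "0 < e"
  \<comment> \<open>The added 1 permits the division when \<open>c = 0\<close>.\<close>
  have pos: "0 < c\<^sup>2 + 1" by (intro add_nonneg_pos) auto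
  obtain n h where h: "h \<in> sq_integrable M (F n)" and fh: "(\<integral>x. (f x - h x)\<^sup>2 \<partial>M) < e / (c\<^sup>2 + 1)"
    using f e pos unfolding L2_approximable_def by (meson divide_pos_pos)
  have "(\<integral>x. (c * f x - c * h x)\<^sup>2 \<partial>M) = c\<^sup>2 * (\<integral>x. (f x - h x)\<^sup>2 \<partial>M)"
    by (simp add: right_diff_distrib[symmetric] power_mult_distrib)
  also have "\<dots> \<le> (c\<^sup>2 + 1) * (\<integral>x. (f x - h x)\<^sup>2 \<partial>M)" by (intro mult_right_mono) auto
  also have "\<dots> < e" using fh pos by (simp add: field_simps)
  finally show "\<exists>l. L2_approximable M F l \<and> (\<integral>x. (c * f x - l x)\<^sup>2 \<partial>M) < e"
    using L2_approximable_member[OF sq_integrable_cmult[OF h]] by blast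
qed

lemma L2_approximable_sum:
  assumes "finite I" "\<And>i. i \<in> I \<Longrightarrow> L2_approximable M F (f i)"
  shows "L2_approximable M F (\<lambda>x. \<Sum>i\<in>I. f i x)"
  using assms
proof (induction I rule: finite_induct)
  case empty
  show ?case by (simp add: L2_approximable_member sq_integrable_const)
next
  case (insert i I)
  then show ?case by (simp add: L2_approximable_add)
qed

text \<open>Dominated convergence: the error is at most \<open>3 * \<bar>f x\<bar>\<close>. The
  factor 2 in the bound is the one that comes with the approximation by simple functions.\<close>

lemma L2_approximable_dominated:
  assumes f: "f \<in> sq_integrable M M" and s: "\<And>i. L2_approximable M F (s i)"
    and lim: "\<And>x. x \<in> space M \<Longrightarrow> (\<lambda>i. s i x) \<longlonglongrightarrow> f x"
    and bound: "\<And>i x. x \<in> space M \<Longrightarrow> \<bar>s i x\<bar> \<le> 2 * \<bar>f x\<bar>"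
  shows "L2_approximable M F f"
proof (rule L2_approximable_limit[OF f])
  fix e :: real assume e: "0 < e"
  have sM: "s i \<in> borel_measurable M" for i
    using s[of i] by (simp add: L2_approximable_def sq_integrable_def)
  have fM: "f \<in> borel_measurable M" using f by (rule sq_integrable_measurable)
  have "(\<lambda>i. \<integral>x. (f x - s i x)\<^sup>2 \<partial>M) \<longlonglongrightarrow> (\<integral>x. 0 \<partial>M)"
  proof (rule integral_dominated_convergence[where w = "\<lambda>x. 9 * (f x)\<^sup>2"])
    show "integrable M (\<lambda>x. 9 * (f x)\<^sup>2)" using sq_integrable_square[OF f] by simp
    show "AE x in M. (\<lambda>i. (f x - s i x)\<^sup>2) \<longlonglongrightarrow> 0"
    proof (rule AE_I2)
      fix x assume "x \<in> space M"
      then have "(\<lambda>i. (f x - s i x)\<^sup>2) \<longlonglongrightarrow> (f x - f x)\<^sup>2" by (intro tendsto_intros lim)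
      then show "(\<lambda>i. (f x - s i x)\<^sup>2) \<longlonglongrightarrow> 0" by simp
    qed
    show "AE x in M. norm ((f x - s i x)\<^sup>2) \<le> 9 * (f x)\<^sup>2" for i
    proof (rule AE_I2)
      fix x assume "x \<in> space M"
      then have "\<bar>f x - s i x\<bar> \<le> 3 * \<bar>f x\<bar>" using bound[of x i] by linarith
      then have "\<bar>f x - s i x\<bar>\<^sup>2 \<le> (3 * \<bar>f x\<bar>)\<^sup>2" by (intro power_mono) auto
      then show "norm ((f x - s i x)\<^sup>2) \<le> 9 * (f x)\<^sup>2" by (simp add: power_mult_distrib)
    qed
  qed (use sM fM in auto)
  then have "\<forall>\<^sub>F i in sequentially. (\<integral>x. (f x - s i x)\<^sup>2 \<partial>M) < e"
    using e by (intro order_tendstoD) auto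
  then obtain i where "(\<integral>x. (f x - s i x)\<^sup>2 \<partial>M) < e" by (auto simp: eventually_sequentially)
  then show "\<exists>g. L2_approximable M F g \<and> (\<integral>x. (f x - g x)\<^sup>2 \<partial>M) < e" using s by blast
qed

lemma Int_stable_union_chain: "Int_stable (\<Union>n. sets (F n))"
proof (rule Int_stableI)
  fix A B assume "A \<in> (\<Union>n. sets (F n))" "B \<in> (\<Union>n. sets (F n))"
  then obtain m n where "A \<in> sets (F m)" "B \<in> sets (F n)" by blast
  then have "A \<in> sets (F (max m n))" "B \<in> sets (F (max m n))"
    using chain[of m "max m n"] chain[of n "max m n"] by (auto simp: subalgebra_def)
  then show "A \<inter> B \<in> (\<Union>n. sets (F n))" by blast
qed

lemma indicator_sq_integrable:
  assumes G: "subalgebra M G" and A: "A \<in> sets G"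
  shows "indicator A \<in> sq_integrable M G"
proof -
  have "integrable M (indicator A :: 'w \<Rightarrow> real)"
    using G A by (intro integrable_real_indicator) (auto simp: subalgebra_def emeasure_eq_measure)
  then show "indicator A \<in> sq_integrable M G"
    using A by (simp add: sq_integrable_def power2_eq_square flip: indicator_inter_arith)
qed

lemma sigma_sets_union_chain_subset: "sigma_sets (space M) (\<Union>n. sets (F n)) \<subseteq> sets M"
  using sub by (intro sets.sigma_sets_subset) (auto simp: subalgebra_def)

text \<open>Dynkin's argument: the union of the chain is closed under intersection, and the sets
  with approximable indicator are closed under complements and countable disjoint unions.\<close>

lemma L2_approximable_indicator:
  assumes A: "A \<in> sigma_sets (space M) (\<Union>n. sets (F n))"
  shows "L2_approximable M F (indicator A)"
proof -
  have "(\<Union>n. sets (F n)) \<subseteq> Pow (space M)"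
    using sub sets.sets_into_space unfolding subalgebra_def by blast
  from Int_stable_union_chain this A show ?thesis
  proof (induction rule: sigma_sets_induct_disjoint)
    case (basic A)
    then show ?case using L2_approximable_member[OF indicator_sq_integrable[OF sub]] by blast
  next
    case empty
    show ?case by (intro L2_approximable_member[of _ 0] indicator_sq_integrable sub sets.empty_sets)
  next
    case (compl A)
    have "L2_approximable M F (\<lambda>x. 1 + - 1 * indicator A x)"
      by (intro L2_approximable_add L2_approximable_cmult compl
          L2_approximable_member[of _ 0, OF sq_integrable_const])
    then have approx: "L2_approximable M F (\<lambda>x. 1 - indicator A x)" by simp
    have AM: "A \<in> sets M" using compl(1) sigma_sets_union_chain_subset by blast
    \<comment> \<open>The two indicator expressions agree only on \<open>space M\<close>. A constant
      sequence in the dominated convergence lemma, which looks at points of the space alone, bridges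
      the gap.\<close>
    show ?case
    proof (rule L2_approximable_dominated[of _ "\<lambda>_ x. 1 - indicator A x"])
      show "indicator (space M - A) \<in> sq_integrable M M"
        using AM by (intro indicator_sq_integrable subalgebra_refl) auto
    qed (use approx in \<open>auto simp: indicator_def\<close>)
  next
    case (union A)
    have A: "A i \<in> sets M" for i using union(2) sigma_sets_union_chain_subset by blast
    show ?case
    proof (rule L2_approximable_dominated)
      show "indicator (\<Union>i. A i) \<in> sq_integrable M M"
        using A by (intro indicator_sq_integrable subalgebra_refl) auto
      show "L2_approximable M F (\<lambda>x. \<Sum>j<i. indicator (A j) x)" for i
        using union(3) by (intro L2_approximable_sum) auto
      have disj: "(\<Sum>j<i. indicator (A j) x) = (indicator (\<Union>j<i. A j) x :: real)" for i x
        using union(1) by (intro indicator_UN_disjoint[symmetric])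
          (auto simp: disjoint_family_on_def)
      show "(\<lambda>i. \<Sum>j<i. indicator (A j) x) \<longlonglongrightarrow> (indicator (\<Union>i. A i) x :: real)" for x
        unfolding disj by (rule LIMSEQ_indicator_UN)
      show "\<bar>\<Sum>j<i. indicator (A j) x\<bar> \<le> 2 * \<bar>indicator (\<Union>i. A i) x :: real\<bar>" for i x
        unfolding disj by (auto simp: indicator_def)
    qed
  qed
qed

text \<open>Simple functions converge to \<open>f\<close> pointwise, and each is a finite linear
  combination of indicators of sets of \<open>K\<close>.\<close>

lemma L2_approximable_measurable:
  assumes K: "subalgebra M K" "sets K \<subseteq> sigma_sets (space M) (\<Union>n. sets (F n))"
    and f: "f \<in> sq_integrable M K"
  shows "L2_approximable M F f"
proof -
  have sp: "space K = space M" using K by (simp add: subalgebra_def)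
  obtain s where s: "\<And>i. simple_function K (s i)" "\<And>x. x \<in> space K \<Longrightarrow> (\<lambda>i. s i x) \<longlonglongrightarrow> f x"
    "\<And>i x. x \<in> space K \<Longrightarrow> dist (s i x) 0 \<le> 2 * dist (f x) 0"
    using borel_measurable_implies_sequence_metric[OF sq_integrable_measurable[OF f], of 0] by metis
  have fM: "f \<in> sq_integrable M M" by (rule sq_integrable_mono[OF f K(1)])
  show ?thesis
  proof (rule L2_approximable_dominated[OF fM])
    fix i
    let ?s = "\<lambda>x. \<Sum>y\<in>s i ` space K. y * indicator (s i -` {y} \<inter> space K) x"
    have "L2_approximable M F ?s"
      using s(1)[of i] K(2)
      by (intro L2_approximable_sum L2_approximable_cmult L2_approximable_indicator)
        (auto simp: simple_function_def)
    then show "L2_approximable M F ?s" .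
  next
    fix x i assume "x \<in> space M"
    then have eq: "(\<Sum>y\<in>s i ` space K. y * indicator (s i -` {y} \<inter> space K) x) = s i x" for i
      unfolding sp[symmetric] real_scaleR_def[symmetric]
      by (subst simple_function_indicator_representation_banach[OF s(1)[of i]])
        (simp_all only: real_scaleR_def mult.commute)
    show "(\<lambda>i. \<Sum>y\<in>s i ` space K. y * indicator (s i -` {y} \<inter> space K) x) \<longlonglongrightarrow> f x"
      unfolding eq using s(2) \<open>x \<in> space M\<close> by (simp add: sp)
    show "\<bar>\<Sum>y\<in>s i ` space K. y * indicator (s i -` {y} \<inter> space K) x\<bar> \<le> 2 * \<bar>f x\<bar>"
      unfolding eq using s(3)[of x i] \<open>x \<in> space M\<close> by (simp add: sp)
  qed
qed

text \<open>Projections are best approximations, so from the index of one good approximant onwards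
  all are as good. Holding for all large \<open>m\<close>, this allows a common index for two
  chains.\<close>

lemma cond_exp_approximates:
  assumes f: "L2_approximable M F f" and e: "0 < e"
  shows "\<exists>n. \<forall>m\<ge>n. (\<integral>x. (f x - real_cond_exp M (F m) f x)\<^sup>2 \<partial>M) < e"
proof -
  have fM: "f \<in> sq_integrable M M" using f by (simp add: L2_approximable_def)
  obtain n h where h: "h \<in> sq_integrable M (F n)" and fh: "(\<integral>x. (f x - h x)\<^sup>2 \<partial>M) < e"
    using f e unfolding L2_approximable_def by blast
  have "(\<integral>x. (f x - real_cond_exp M (F m) f x)\<^sup>2 \<partial>M) < e" if "n \<le> m" for m
  proof -
    let ?p = "real_cond_exp M (F m) f"
    have hm: "h \<in> sq_integrable M (F m)" by (rule sq_integrable_mono[OF h chain[OF that]])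
    have p: "?p \<in> sq_integrable M (F m)" by (rule cond_exp_sq_integrable[OF sub fM])
    have hM: "h \<in> sq_integrable M M" and pM: "?p \<in> sq_integrable M M"
      using sq_integrable_mono[OF hm sub] sq_integrable_mono[OF p sub] by auto
    have hp: "(\<integral>x. h x * ?p x \<partial>M) = (\<integral>x. f x * h x \<partial>M)"
      using integral_times_cond_exp[OF sub hm fM] by (simp add: mult.commute)
    have pp: "(\<integral>x. (?p x)\<^sup>2 \<partial>M) = (\<integral>x. f x * ?p x \<partial>M)"
      using integral_times_cond_exp[OF sub p fM] by (simp add: mult.commute power2_eq_square)
    have "0 \<le> (\<integral>x. (h x - ?p x)\<^sup>2 \<partial>M)" by simp
    then show ?thesis
      using fh unfolding integral_square_diff[OF hM pM] integral_square_diff[OF fM pM]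
        integral_square_diff[OF fM hM] by (simp add: hp pp)
  qed
  then show ?thesis by blast
qed

end

section \<open>Passing a correlation bound to the limit\<close>

lemma (in prob_space) proj_sqnorm_le:
  assumes "subalgebra M F" "f \<in> sq_integrable M M"
  shows "proj_sqnorm M f F \<le> (\<integral>x. (f x)\<^sup>2 \<partial>M)"
  using proj_sqnorm_mono[OF subalgebra_refl assms] proj_sqnorm_measurable[OF subalgebra_refl assms(2)]
  by simp

text \<open>Conditional expectations serve as approximants because they keep the mean zero and do
  not increase the norm, so \<open>bound\<close> applies to them with the norms of \<open>f\<close>
  and \<open>g\<close> on the right.\<close>

lemma (in prob_space) correlation_bound_limit:
  assumes F: "subalgebra_chain M F" and G: "subalgebra_chain M G"
    and K: "subalgebra M K" "sets K \<subseteq> sigma_sets (space M) (\<Union>n. sets (F n))"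
    and L: "subalgebra M L" "sets L \<subseteq> sigma_sets (space M) (\<Union>n. sets (G n))"
    and c: "0 \<le> c"
    and bound: "\<And>n f g. \<lbrakk>f \<in> sq_integrable M (F n); g \<in> sq_integrable M (G n); expectation f = 0\<rbrakk> \<Longrightarrow>
      \<bar>\<integral>x. f x * g x \<partial>M\<bar> \<le> c * sqrt (\<integral>x. (f x)\<^sup>2 \<partial>M) * sqrt (\<integral>x. (g x)\<^sup>2 \<partial>M)"
    and f: "f \<in> sq_integrable M K" and g: "g \<in> sq_integrable M L" and f0: "expectation f = 0"
  shows "\<bar>\<integral>x. f x * g x \<partial>M\<bar> \<le> c * sqrt (\<integral>x. (f x)\<^sup>2 \<partial>M) * sqrt (\<integral>x. (g x)\<^sup>2 \<partial>M)"
proof -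
  interpret F: subalgebra_chain M F by (rule F)
  interpret G: subalgebra_chain M G by (rule G)
  define a b where "a = sqrt (\<integral>x. (f x)\<^sup>2 \<partial>M)" and "b = sqrt (\<integral>x. (g x)\<^sup>2 \<partial>M)"
  have ab: "0 \<le> a" "0 \<le> b" by (auto simp: a_def b_def)
  have fM: "f \<in> sq_integrable M M" and gM: "g \<in> sq_integrable M M"
    using sq_integrable_mono[OF f K(1)] sq_integrable_mono[OF g L(1)] by auto
  have main: "\<bar>\<integral>x. f x * g x \<partial>M\<bar> \<le> c * a * b + e * (a + b)" if e: "0 < e" for e
  proof -
    have e2: "0 < e\<^sup>2" using e by simp
    obtain n1 where n1: "\<And>m. n1 \<le> m \<Longrightarrow> (\<integral>x. (f x - real_cond_exp M (F m) f x)\<^sup>2 \<partial>M) < e\<^sup>2"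
      using F.cond_exp_approximates[OF F.L2_approximable_measurable[OF K f] e2] by blast
    obtain n2 where n2: "\<And>m. n2 \<le> m \<Longrightarrow> (\<integral>x. (g x - real_cond_exp M (G m) g x)\<^sup>2 \<partial>M) < e\<^sup>2"
      using G.cond_exp_approximates[OF G.L2_approximable_measurable[OF L g] e2] by blast
    define n where "n = max n1 n2"
    define p q where "p = real_cond_exp M (F n) f" and "q = real_cond_exp M (G n) g"
    have p: "p \<in> sq_integrable M (F n)" and q: "q \<in> sq_integrable M (G n)"
      using cond_exp_sq_integrable F.sub G.sub fM gM by (auto simp: p_def q_def)
    have pM: "p \<in> sq_integrable M M" and qM: "q \<in> sq_integrable M M"
      using sq_integrable_mono[OF p F.sub] sq_integrable_mono[OF q G.sub] by auto
    interpret S: sigma_finite_subalgebra M "F n" by (rule subalgebra_sigma_finite[OF F.sub])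
    have p0: "expectation p = 0"
      using S.real_cond_exp_int(2)[OF integrable_sq_integrable[OF fM]] f0 by (simp add: p_def)
    have norms: "sqrt (\<integral>x. (p x)\<^sup>2 \<partial>M) \<le> a" "sqrt (\<integral>x. (q x)\<^sup>2 \<partial>M) \<le> b"
      using proj_sqnorm_le[OF F.sub fM] proj_sqnorm_le[OF G.sub gM]
      by (auto simp: a_def b_def p_def q_def proj_sqnorm_def)
    have errs: "sqrt (\<integral>x. (f x - p x)\<^sup>2 \<partial>M) \<le> e" "sqrt (\<integral>x. (g x - q x)\<^sup>2 \<partial>M) \<le> e"
      using n1[of n] n2[of n] e by (auto simp: n_def p_def q_def intro!: real_le_lsqrt)
    have fp: "(\<lambda>x. f x - p x) \<in> sq_integrable M M" and gq: "(\<lambda>x. g x - q x) \<in> sq_integrable M M"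
      using sq_integrable_diff[OF fM pM subalgebra_refl] sq_integrable_diff[OF gM qM subalgebra_refl] by auto
    have "(\<integral>x. f x * g x \<partial>M) = (\<integral>x. p x * q x + (f x - p x) * g x + p x * (g x - q x) \<partial>M)"
      by (simp add: algebra_simps)
    also have "\<dots> = (\<integral>x. p x * q x \<partial>M) + (\<integral>x. (f x - p x) * g x \<partial>M) + (\<integral>x. p x * (g x - q x) \<partial>M)"
      using integrable_times[OF pM qM] integrable_times[OF fp gM] integrable_times[OF pM gq] by simp
    finally have "\<bar>\<integral>x. f x * g x \<partial>M\<bar> \<le> \<bar>\<integral>x. p x * q x \<partial>M\<bar>
        + \<bar>\<integral>x. (f x - p x) * g x \<partial>M\<bar> + \<bar>\<integral>x. p x * (g x - q x) \<partial>M\<bar>" by linarith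
    moreover have "\<bar>\<integral>x. p x * q x \<partial>M\<bar> \<le> c * a * b"
      using ab c by (intro order_trans[OF bound[OF p q p0]] mult_mono norms mult_left_mono
          mult_nonneg_nonneg) auto
    moreover have "\<bar>\<integral>x. (f x - p x) * g x \<partial>M\<bar> \<le> e * b"
      by (rule order_trans[OF Cauchy_Schwarz_integral[OF fp gM]])
        (use errs ab e in \<open>auto simp: b_def intro!: mult_right_mono\<close>)
    moreover have "\<bar>\<integral>x. p x * (g x - q x) \<partial>M\<bar> \<le> a * e"
      using ab e by (intro order_trans[OF Cauchy_Schwarz_integral[OF pM gq]] mult_mono norms errs) auto
    ultimately show ?thesis by (simp add: algebra_simps)
  qed
  have "\<bar>\<integral>x. f x * g x \<partial>M\<bar> \<le> c * a * b"
  proof (rule field_le_epsilon)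
    fix d :: real assume d: "0 < d"
    have pos: "0 < a + b + 1" using ab by simp
    have "\<bar>\<integral>x. f x * g x \<partial>M\<bar> \<le> c * a * b + d / (a + b + 1) * (a + b)"
      using pos d by (intro main) auto
    also have "d / (a + b + 1) * (a + b) \<le> d" using pos d ab by (simp add: field_simps)
    finally show "\<bar>\<integral>x. f x * g x \<partial>M\<bar> \<le> c * a * b + d" by simp
  qed
  then show ?thesis by (simp add: a_def b_def)
qed

section \<open>Correlation of the generated subalgebras\<close>

lemma sd_nonneg: "0 \<le> sd M f"
  by (simp add: sd_def)

lemma cond_corr_le_mono:
  assumes "cond_corr_le M F G H e" "e \<le> e'"
  shows "cond_corr_le M F G H e'"
  unfolding cond_corr_le_def
proof (intro ballI impI)
  fix f g assume fg: "f \<in> sq_integrable M F" "g \<in> sq_integrable M G"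
    "AE x in M. real_cond_exp M H f x = 0" "AE x in M. real_cond_exp M H g x = 0"
  have "\<bar>\<integral>x. f x * g x \<partial>M\<bar> \<le> e * sd M f * sd M g"
    using assms(1) fg unfolding cond_corr_le_def by blast
  also have "\<dots> \<le> e' * sd M f * sd M g"
    using assms(2) by (intro mult_right_mono sd_nonneg)
  finally show "\<bar>\<integral>x. f x * g x \<partial>M\<bar> \<le> e' * sd M f * sd M g" .
qed

text \<open>\<open>LEAST\<close> on the reals is meaningful once a minimum is attained. So the
  infimum \<open>m\<close> of the admissible values is shown to be admissible and then identified
  with \<open>subj_corr\<close>.\<close>

lemma (in prob_space) subj_corr_props:
  assumes F: "subalgebra M (sigma_join M F H)" and G: "subalgebra M (sigma_join M G H)"
    and H: "subalgebra M H"
  shows "0 \<le> subj_corr M F G H" "subj_corr M F G H \<le> 1"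
    "cond_corr_le M (sigma_join M F H) (sigma_join M G H) H (subj_corr M F G H)"
proof -
  define Q where "Q e \<longleftrightarrow> 0 \<le> e \<and> e \<le> 1 \<and>
    cond_corr_le M (sigma_join M F H) (sigma_join M G H) H e" for e
  have subj: "subj_corr M F G H = (LEAST e. Q e)"
    unfolding subj_corr_def Q_def cond_corr_le_def ..
  have Q1: "Q 1"
    unfolding Q_def cond_corr_le_def
  proof (intro conjI ballI impI)
    fix f g assume f: "f \<in> sq_integrable M (sigma_join M F H)"
      and g: "g \<in> sq_integrable M (sigma_join M G H)"
      and f0: "AE x in M. real_cond_exp M H f x = 0" and g0: "AE x in M. real_cond_exp M H g x = 0"
    have fM: "f \<in> sq_integrable M M" and gM: "g \<in> sq_integrable M M"
      using sq_integrable_mono[OF f F] sq_integrable_mono[OF g G] by auto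
    have "sd M f = sqrt (\<integral>x. (f x)\<^sup>2 \<partial>M)" "sd M g = sqrt (\<integral>x. (g x)\<^sup>2 \<partial>M)"
      using f0 g0 fM gM
      by (auto intro!: sd_centred expectation_cond_exp_zero[OF H] integrable_sq_integrable)
    then show "\<bar>\<integral>x. f x * g x \<partial>M\<bar> \<le> 1 * sd M f * sd M g"
      using Cauchy_Schwarz_integral[OF fM gM] by simp
  qed auto
  define m where "m = Inf (Collect Q)"
  have bdd: "bdd_below (Collect Q)" by (rule bdd_belowI[of _ 0]) (auto simp: Q_def)
  have lower: "m \<le> e" if "Q e" for e unfolding m_def using that bdd by (intro cInf_lower) auto
  have "Q m"
    unfolding Q_def cond_corr_le_def
  proof (intro conjI ballI impI)
    show "0 \<le> m" unfolding m_def using Q1 by (intro cInf_greatest) (auto simp: Q_def)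
    show "m \<le> 1" by (rule lower[OF Q1])
    fix f g assume fg: "f \<in> sq_integrable M (sigma_join M F H)" "g \<in> sq_integrable M (sigma_join M G H)"
      "AE x in M. real_cond_exp M H f x = 0" "AE x in M. real_cond_exp M H g x = 0"
    define c where "c = sd M f * sd M g"
    have le: "\<bar>\<integral>x. f x * g x \<partial>M\<bar> \<le> e * c" if "Q e" for e
      using that fg unfolding Q_def cond_corr_le_def c_def by (simp add: mult.assoc)
    have "0 \<le> c" by (simp add: c_def sd_nonneg)
    then consider "c = 0" | "0 < c" by fastforce
    then have "\<bar>\<integral>x. f x * g x \<partial>M\<bar> \<le> m * c"
    proof cases
      case 1
      then show ?thesis using le[OF Q1] by simp
    next
      case 2
      \<comment> \<open>For fixed \<open>f\<close> and \<open>g\<close> every admissible value is at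
        least this ratio, hence so is the infimum.\<close>
      have "\<bar>\<integral>x. f x * g x \<partial>M\<bar> / c \<le> m"
        unfolding m_def using Q1 le 2 by (intro cInf_greatest) (auto simp: divide_le_eq)
      then show ?thesis using 2 by (simp add: divide_le_eq)
    qed
    then show "\<bar>\<integral>x. f x * g x \<partial>M\<bar> \<le> m * sd M f * sd M g" by (simp add: c_def mult.assoc)
  qed
  then have "subj_corr M F G H = m"
    unfolding subj by (rule Least_equality) (rule lower)
  then show "0 \<le> subj_corr M F G H" "subj_corr M F G H \<le> 1"
    "cond_corr_le M (sigma_join M F H) (sigma_join M G H) H (subj_corr M F G H)"
    using \<open>Q m\<close> by (auto simp: Q_def)
qed

section \<open>Sigma-algebras generated by subfamilies\<close>

definition generated :: "'w measure \<Rightarrow> ('k \<Rightarrow> 'w measure) \<Rightarrow> 'k set \<Rightarrow> 'w measure" where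
  "generated M S K = sigma (space M) (\<Union>k\<in>K. sets (S k))"

locale subalgebra_family = prob_space M for M :: "'w measure" +
  fixes S :: "'k \<Rightarrow> 'w measure"
  assumes sub: "\<And>k. subalgebra M (S k)"
begin

lemma generators_Pow: "(\<Union>k\<in>K. sets (S k)) \<subseteq> Pow (space M)"
  using sub sets.sets_into_space unfolding subalgebra_def by blast

lemma space_generated: "space (generated M S K) = space M"
  unfolding generated_def by (simp add: space_measure_of generators_Pow)

lemma sets_generated: "sets (generated M S K) = sigma_sets (space M) (\<Union>k\<in>K. sets (S k))"
  unfolding generated_def by (simp add: sets_measure_of generators_Pow)

lemma generated_least:
  assumes "\<And>k. k \<in> K \<Longrightarrow> sets (S k) \<subseteq> sets N" "space N = space M"
  shows "sets (generated M S K) \<subseteq> sets N"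
  unfolding sets_generated assms(2)[symmetric] using assms(1) by (intro sets.sigma_sets_subset) blast

lemma subalgebra_generated: "subalgebra M (generated M S K)"
  using generated_least[of K M] sub by (auto simp: subalgebra_def space_generated)

lemma sets_le_generated: "k \<in> K \<Longrightarrow> sets (S k) \<subseteq> sets (generated M S K)"
  unfolding sets_generated by (auto intro: sigma_sets.Basic)

lemma generated_mono: "K \<subseteq> K' \<Longrightarrow> subalgebra (generated M S K') (generated M S K)"
  using generated_least[of K "generated M S K'"] sets_le_generated
  by (auto simp: subalgebra_def space_generated)

text \<open>Translates the joins in \<open>subj_corr\<close> into lattice steps, which add one index
  to the family. Both inclusions follow from minimality.\<close>

lemma sets_sigma_join_generated:
  "sets (sigma_join M (S k) (generated M S K)) = sets (generated M S (insert k K))"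
proof -
  let ?U = "sets (S k) \<union> sets (generated M S K)"
  have "?U \<subseteq> Pow (space M)"
    using generators_Pow[of "{k}"] sets.space_closed[of "generated M S K"] by (auto simp: space_generated)
  then have join: "sets (sigma_join M (S k) (generated M S K)) = sigma_sets (space M) ?U"
    "space (sigma_join M (S k) (generated M S K)) = space M"
    by (auto simp: sigma_join_def sets_measure_of space_measure_of)
  show ?thesis
  proof
    have "?U \<subseteq> sets (generated M S (insert k K))"
      using sets_le_generated[of k "insert k K"] generated_mono[of K "insert k K"]
      by (auto simp: subalgebra_def)
    then show "sets (sigma_join M (S k) (generated M S K)) \<subseteq> sets (generated M S (insert k K))"
      unfolding join(1) space_generated[of "insert k K", symmetric] by (rule sets.sigma_sets_subset)
    show "sets (generated M S (insert k K)) \<subseteq> sets (sigma_join M (S k) (generated M S K))"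
    proof (rule generated_least[OF _ join(2)])
      fix l assume "l \<in> insert k K"
      then have "sets (S l) \<subseteq> ?U" using sets_le_generated[of l K] by auto
      then show "sets (S l) \<subseteq> sets (sigma_join M (S k) (generated M S K))"
        unfolding join(1) by (auto intro: sigma_sets.Basic)
    qed
  qed
qed

lemma sq_integrable_sigma_join:
  "sq_integrable M (sigma_join M (S k) (generated M S K)) = sq_integrable M (generated M S (insert k K))"
  unfolding sq_integrable_def
  by (simp add: measurable_cong_sets[OF sets_sigma_join_generated refl])

lemma subalgebra_sigma_join: "subalgebra M (sigma_join M (S k) (generated M S K))"
proof -
  have "space (sigma_join M (S k) (generated M S K)) = space (generated M S (insert k K))"
    by (rule sets_eq_imp_space_eq[OF sets_sigma_join_generated])
  then show ?thesis
    using subalgebra_generated[of "insert k K"]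
    by (simp add: subalgebra_def sets_sigma_join_generated)
qed

text \<open>Every \<open>generated M S K\<close> is a member of the metalgebra. The supremum is
  taken in the reals, so it dominates its members only because they are bounded, here by 1.\<close>

lemma meta_corr_cond_corr_le:
  assumes "meta_corr M (S k) (S l) (metalgebra M S UNIV) \<le> e"
  shows "cond_corr_le M (generated M S (insert k K)) (generated M S (insert l K)) (generated M S K) e"
proof -
  have "bdd_above ((\<lambda>H. subj_corr M (S k) (S l) H) ` metalgebra M S UNIV)"
    unfolding metalgebra_def generated_def[symmetric]
    by (rule bdd_aboveI[of _ 1])
      (auto intro!: subj_corr_props subalgebra_sigma_join subalgebra_generated)
  moreover have "generated M S K \<in> metalgebra M S UNIV"
    unfolding metalgebra_def generated_def by blast
  ultimately have "subj_corr M (S k) (S l) (generated M S K) \<le> meta_corr M (S k) (S l) (metalgebra M S UNIV)"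
    unfolding meta_corr_def by (rule cSUP_upper[rotated])
  then have "subj_corr M (S k) (S l) (generated M S K) \<le> e" using assms by linarith
  then have "cond_corr_le M (sigma_join M (S k) (generated M S K)) (sigma_join M (S l) (generated M S K))
      (generated M S K) e"
    by (intro cond_corr_le_mono[OF subj_corr_props(3)] subalgebra_sigma_join subalgebra_generated)
  then show ?thesis unfolding cond_corr_le_def sq_integrable_sigma_join .
qed

text \<open>The empty family generates the trivial sigma-algebra, on which the projection is the
  mean. This supplies the corner condition of \<open>staircase_bound\<close>.\<close>

lemma proj_sqnorm_generated_empty:
  assumes f: "f \<in> sq_integrable M M" and f0: "expectation f = 0"
  shows "proj_sqnorm M f (generated M S {}) = 0"
proof -
  interpret T: sigma_finite_subalgebra M "generated M S {}"
    by (rule subalgebra_sigma_finite[OF subalgebra_generated])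
  have "AE x in M. real_cond_exp M (generated M S {}) f x = 0"
  proof (rule T.real_cond_exp_charact)
    fix A assume "A \<in> sets (generated M S {})"
    then have "A = {} \<or> A = space M" by (simp add: sets_generated sigma_sets_empty_eq)
    moreover have "(\<integral>x\<in>space M. f x \<partial>M) = expectation f"
      by (rule set_integral_space[OF integrable_sq_integrable[OF f]])
    ultimately show "(\<integral>x\<in>A. f x \<partial>M) = (\<integral>x\<in>A. 0 \<partial>M)" using f0 by (auto simp: set_lebesgue_integral_def)
  qed (use integrable_sq_integrable[OF f] in auto)
  then have "proj_sqnorm M f (generated M S {}) = (\<integral>x. 0 \<partial>M)"
    unfolding proj_sqnorm_def by (intro integral_cong_AE) auto
  then show ?thesis by simp
qed

end

section \<open>The correlation bound for finitely many variables\<close>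

lemma arcsin_add_le_sin:
  assumes "0 \<le> e" "e \<le> 1" "0 \<le> d" "arcsin e + d \<le> pi / 2"
  shows "e \<le> sin (arcsin e + d)"
proof -
  have "e = sin (arcsin e)" using assms by simp
  also have "\<dots> \<le> sin (arcsin e + d)"
    using assms arcsin_bounded[of e] by (intro sin_monotone_2pi_le) auto
  finally show ?thesis .
qed

text \<open>The staircase argument for the \<open>X i\<close> and \<open>Y j\<close> of a window. It
  requires positive angles, so each \<open>arcsin (\<epsilon> z)\<close> is enlarged by
  \<open>d\<close>, and \<open>d\<close> tends to 0 at the end.\<close>

lemma (in subalgebra_family) proj_sqnorm_window:
  fixes \<epsilon> :: "int \<Rightarrow> real" and x y :: "int \<Rightarrow> 'k" and n :: nat
  defines "W \<equiv> {- int n..<int n}" and "Z \<equiv> {- 2 * int n..<2 * int n}"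
  assumes \<epsilon>: "\<And>z. 0 \<le> \<epsilon> z \<and> \<epsilon> z \<le> 1"
    and corr: "\<And>i j K. cond_corr_le M (generated M S (insert (x i) K)) (generated M S (insert (y j) K))
      (generated M S K) (\<epsilon> (j - i))"
    and small: "(\<Sum>z\<in>Z. arcsin (\<epsilon> z)) < pi / 2"
    and f: "f \<in> sq_integrable M (generated M S (x ` W))" and f0: "expectation f = 0"
  shows "proj_sqnorm M f (generated M S (y ` W)) \<le> (sin (\<Sum>z\<in>Z. arcsin (\<epsilon> z)))\<^sup>2 * (\<integral>x. (f x)\<^sup>2 \<partial>M)"
proof -
  define V where "V a b = generated M S (x ` {- int n..<a} \<union> y ` {- int n..<b})" for a b
  define N where "N a b = proj_sqnorm M f (V a b)" for a b
  define T where "T = (\<integral>x. (f x)\<^sup>2 \<partial>M)"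
  \<comment> \<open>Counts the summands \<open>d\<close>: one for each angle over \<open>Z\<close>,
    and one for the initial angle.\<close>
  define c where "c = 1 + real (card Z)"
  define \<Theta> where "\<Theta> = (\<Sum>z\<in>Z. arcsin (\<epsilon> z))"
  have as: "0 \<le> arcsin (\<epsilon> z)" for z using \<epsilon>[of z] arcsin_le_arcsin[of 0 "\<epsilon> z"] by simp
  have c: "0 < c" by (simp add: c_def)
  have fM: "f \<in> sq_integrable M M" by (rule sq_integrable_mono[OF f subalgebra_generated])
  have VM: "subalgebra M (V a b)" for a b unfolding V_def by (rule subalgebra_generated)
  have V1: "subalgebra (V (a + 1) b) (V a b)" and V2: "subalgebra (V a (b + 1)) (V a b)" for a b
    unfolding V_def by (auto intro!: generated_mono)
  have mono: "N a b \<le> N (a + 1) b" "N a b \<le> N a (b + 1)" for a b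
    unfolding N_def using proj_sqnorm_mono[OF VM V1 fM] proj_sqnorm_mono[OF VM V2 fM] by auto
  have bound: "N (- int n) (int n) \<le> (sin (\<Theta> + c * d))\<^sup>2 * T"
    if d: "0 < d" "\<Theta> + c * d \<le> pi / 2" for d
  proof -
    define \<theta> where "\<theta> z = arcsin (\<epsilon> z) + d" for z
    have \<theta>: "0 < \<theta> z" for z using as[of z] d by (simp add: \<theta>_def)
    have total: "d + (\<Sum>z\<in>Z. \<theta> z) = \<Theta> + c * d"
      by (simp add: \<theta>_def \<Theta>_def c_def sum.distrib algebra_simps)
    have "N (- int n) (int n) \<le> (sin (d + (\<Sum>z\<in>{- 2 * int n..<2 * int n}. \<theta> z)))\<^sup>2 * T"
    proof (rule staircase_bound[where N = N and \<theta> = \<theta>, OF mono])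
      fix a b A assume A: "0 < A" "A + \<theta> (b - a) \<le> pi / 2"
      let ?t = "\<theta> (b - a)"
      have pos: "0 < sin ?t" "0 < cos A" "0 < sin A" "0 \<le> sin (A + ?t)" "0 \<le> cos ?t" "0 \<le> cos (A + ?t)"
        using A \<theta>[of "b - a"] by (auto intro!: sin_gt_zero cos_gt_zero sin_ge_zero cos_ge_zero)
      have nonneg: "0 \<le> sin (A + ?t) * (sin ?t / cos A * (N (a + 1) b - N a b)
         + cos ?t / sin A * (N (a + 1) (b + 1) - N (a + 1) b))"
        using pos mono by (intro mult_nonneg_nonneg add_nonneg_nonneg divide_nonneg_nonneg) auto
      \<comment> \<open>The staircases extend beyond the window. Below it and to its left an edge of
        the square carries no increment, and the inequality has to be checked by hand.\<close>
      consider "b < - int n" | "a < - int n" | "- int n \<le> a" "- int n \<le> b" by linarith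
      then show "N a (b + 1) - N a b \<le> sin (A + ?t) * (sin ?t / cos A * (N (a + 1) b - N a b)
         + cos ?t / sin A * (N (a + 1) (b + 1) - N (a + 1) b))"
      proof cases
        case 1
        then have "N a (b + 1) = N a b" by (simp add: N_def V_def)
        then show ?thesis using nonneg by simp
      next
        case 2
        then have eq: "N (a + 1) b' = N a b'" for b' by (simp add: N_def V_def)
        \<comment> \<open>The horizontal increment vanishes and both vertical ones coincide, so the
          claim is that the remaining factor is at least 1.\<close>
        have "sin A = sin (A + ?t) * cos ?t - cos (A + ?t) * sin ?t"
          using sin_diff[of "A + ?t" ?t] by simp
        also have "\<dots> \<le> sin (A + ?t) * cos ?t" using pos by simp
        finally have "1 \<le> sin (A + ?t) * cos ?t / sin A" using pos by simp
        then have "1 * (N a (b + 1) - N a b) \<le> sin (A + ?t) * cos ?t / sin A * (N a (b + 1) - N a b)"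
          using mono(2) by (intro mult_right_mono) auto
        then show ?thesis by (simp add: eq)
      next
        case 3
        define K where "K = x ` {- int n..<a} \<union> y ` {- int n..<b}"
        have "{- int n..<a + 1} = insert a {- int n..<a}" "{- int n..<b + 1} = insert b {- int n..<b}"
          using 3 by auto
        then have V: "V (a + 1) b = generated M S (insert (x a) K)"
          "V a (b + 1) = generated M S (insert (y b) K)" "V a b = generated M S K"
          by (auto simp: V_def K_def)
        have "\<epsilon> (b - a) \<le> sin ?t" unfolding \<theta>_def
          using \<epsilon>[of "b - a"] A d by (intro arcsin_add_le_sin) (auto simp: \<theta>_def)
        then have "cond_corr_le M (V (a + 1) b) (V a (b + 1)) (V a b) (sin ?t)"
          unfolding V by (rule cond_corr_le_mono[OF corr])
        then show ?thesis
          unfolding N_def using A \<theta>[of "b - a"]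
          by (intro proj_sqnorm_square_bound[OF VM V2 V1 V1 V2 fM])
      qed
    next
      fix a b :: int
      show "N a b = T" if "int n \<le> a"
      proof -
        have "f \<in> sq_integrable M (V a b)"
          unfolding V_def W_def using that
          by (intro sq_integrable_mono[OF f] generated_mono) (auto simp: W_def)
        then show ?thesis unfolding N_def T_def by (intro proj_sqnorm_measurable VM)
      qed
      show "N a b = N a (- int n)" if "b \<le> - int n" using that by (simp add: N_def V_def)
      show "N a b = N (- int n) b" if "a \<le> - int n" using that by (simp add: N_def V_def)
      show "N (- int n) (- int n) = 0"
        using proj_sqnorm_generated_empty[OF fM f0] by (simp add: N_def V_def)
    qed (use \<theta> d total in \<open>auto simp: Z_def\<close>)
    then show ?thesis using total by (simp add: Z_def)
  qed
  have "N (- int n) (int n) \<le> (sin \<Theta>)\<^sup>2 * T"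
  proof (rule tendsto_lowerbound)
    have "((\<lambda>d. (sin (\<Theta> + c * d))\<^sup>2 * T) \<longlongrightarrow> (sin (\<Theta> + c * 0))\<^sup>2 * T) (at_right 0)"
      by (intro tendsto_intros)
    then show "((\<lambda>d. (sin (\<Theta> + c * d))\<^sup>2 * T) \<longlongrightarrow> (sin \<Theta>)\<^sup>2 * T) (at_right 0)" by simp
    \<comment> \<open>The strict inequality \<open>small\<close> leaves room for a positive
      \<open>d\<close>.\<close>
    have "0 < (pi / 2 - \<Theta>) / c" using small c by (simp add: \<Theta>_def)
    then have "\<forall>\<^sub>F d in at_right 0. d < (pi / 2 - \<Theta>) / c"
      by (intro order_tendstoD(2)[OF tendsto_ident_at])
    moreover have "\<forall>\<^sub>F d in at_right 0. (0::real) < d" by (rule eventually_at_right_less)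
    ultimately show "\<forall>\<^sub>F d in at_right 0. N (- int n) (int n) \<le> (sin (\<Theta> + c * d))\<^sup>2 * T"
    proof eventually_elim
      case (elim d)
      then show ?case using c by (intro bound) (auto simp: field_simps)
    qed
  qed auto
  then show ?thesis by (simp add: N_def V_def T_def \<Theta>_def W_def)
qed

text \<open>Pairing \<open>f\<close> with \<open>g\<close> only sees the projection of
  \<open>f\<close> to the functions of the \<open>Y j\<close>, whose norm was bounded before. The
  alternative \<open>s = 1\<close> covers the truncation at \<open>pi / 2\<close>, where
  Cauchy-Schwarz suffices.\<close>

lemma (in subalgebra_family) window_correlation_bound:
  fixes \<epsilon> :: "int \<Rightarrow> real" and x y :: "int \<Rightarrow> 'k" and n :: nat and s :: real
  defines "W \<equiv> {- int n..<int n}" and "Z \<equiv> {- 2 * int n..<2 * int n}"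
  assumes \<epsilon>: "\<And>z. 0 \<le> \<epsilon> z \<and> \<epsilon> z \<le> 1"
    and corr: "\<And>i j K. cond_corr_le M (generated M S (insert (x i) K)) (generated M S (insert (y j) K))
      (generated M S K) (\<epsilon> (j - i))"
    and s: "0 \<le> s" "s \<le> 1" "s = 1 \<or> (\<Sum>z\<in>Z. arcsin (\<epsilon> z)) \<le> arcsin s"
    and f: "f \<in> sq_integrable M (generated M S (x ` W))" and f0: "expectation f = 0"
    and g: "g \<in> sq_integrable M (generated M S (y ` W))"
  shows "\<bar>\<integral>x. f x * g x \<partial>M\<bar> \<le> s * sqrt (\<integral>x. (f x)\<^sup>2 \<partial>M) * sqrt (\<integral>x. (g x)\<^sup>2 \<partial>M)"
proof (cases "s = 1")
  case True
  then show ?thesis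
    using Cauchy_Schwarz_integral[OF sq_integrable_mono[OF f subalgebra_generated]
        sq_integrable_mono[OF g subalgebra_generated]] by simp
next
  case False
  let ?Y = "generated M S (y ` W)"
  have fM: "f \<in> sq_integrable M M" and gM: "g \<in> sq_integrable M M"
    using sq_integrable_mono[OF f subalgebra_generated] sq_integrable_mono[OF g subalgebra_generated] by auto
  have Pf: "real_cond_exp M ?Y f \<in> sq_integrable M M"
    by (intro sq_integrable_mono[OF cond_exp_sq_integrable[OF _ fM]] subalgebra_generated)
  have sum: "(\<Sum>z\<in>Z. arcsin (\<epsilon> z)) \<le> arcsin s" using s False by auto
  have "arcsin s < arcsin 1" using s False by (intro arcsin_less_arcsin) auto
  then have small: "(\<Sum>z\<in>Z. arcsin (\<epsilon> z)) < pi / 2" using sum by simp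
  have nonneg: "0 \<le> (\<Sum>z\<in>Z. arcsin (\<epsilon> z))"
    using \<epsilon> arcsin_le_arcsin[of 0] by (intro sum_nonneg) simp
  have sin_le: "sin (\<Sum>z\<in>Z. arcsin (\<epsilon> z)) \<le> s"
  proof -
    have "sin (\<Sum>z\<in>Z. arcsin (\<epsilon> z)) \<le> sin (arcsin s)"
      using sum nonneg s arcsin_bounded[of s] by (intro sin_monotone_2pi_le) auto
    then show ?thesis using s by simp
  qed
  have sin_ge: "0 \<le> sin (\<Sum>z\<in>Z. arcsin (\<epsilon> z))"
    using nonneg small by (intro sin_ge_zero) auto
  have "proj_sqnorm M f ?Y \<le> (sin (\<Sum>z\<in>Z. arcsin (\<epsilon> z)))\<^sup>2 * (\<integral>x. (f x)\<^sup>2 \<partial>M)"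
    unfolding W_def Z_def
    by (rule proj_sqnorm_window[where \<epsilon> = \<epsilon> and x = x, OF \<epsilon> corr
          small[unfolded Z_def] f[unfolded W_def] f0])
  also have "\<dots> \<le> s\<^sup>2 * (\<integral>x. (f x)\<^sup>2 \<partial>M)"
    using sin_le sin_ge by (intro mult_right_mono power_mono) auto
  finally have "sqrt (proj_sqnorm M f ?Y) \<le> sqrt (s\<^sup>2 * (\<integral>x. (f x)\<^sup>2 \<partial>M))" by (rule real_sqrt_le_mono)
  then have le: "sqrt (proj_sqnorm M f ?Y) \<le> s * sqrt (\<integral>x. (f x)\<^sup>2 \<partial>M)"
    using s by (simp add: real_sqrt_mult)
  have "(\<integral>x. f x * g x \<partial>M) = (\<integral>x. real_cond_exp M ?Y f x * g x \<partial>M)"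
    using integral_times_cond_exp[OF subalgebra_generated g fM] by (simp add: mult.commute)
  also have "\<bar>\<dots>\<bar> \<le> sqrt (proj_sqnorm M f ?Y) * sqrt (\<integral>x. (g x)\<^sup>2 \<partial>M)"
    unfolding proj_sqnorm_def by (rule Cauchy_Schwarz_integral[OF Pf gM])
  also have "\<dots> \<le> s * sqrt (\<integral>x. (f x)\<^sup>2 \<partial>M) * sqrt (\<integral>x. (g x)\<^sup>2 \<partial>M)"
    using le by (intro mult_right_mono) auto
  finally show ?thesis .
qed

section \<open>From windows to the whole families\<close>

lemma (in subalgebra_family) subalgebra_chain_windows:
  "subalgebra_chain M (\<lambda>n. generated M S (x ` {- int n..<int n}))"
  by unfold_locales (auto intro!: subalgebra_generated generated_mono)

lemma (in subalgebra_family) sets_generated_range: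
  fixes x :: "int \<Rightarrow> 'k"
  shows "sets (generated M S (range x)) \<subseteq>
    sigma_sets (space M) (\<Union>n::nat. sets (generated M S (x ` {- int n..<int n})))"
proof -
  have "(\<Union>k\<in>range x. sets (S k)) \<subseteq> (\<Union>n::nat. sets (generated M S (x ` {- int n..<int n})))"
  proof (rule UN_least)
    fix k assume "k \<in> range x"
    then obtain i where k: "k = x i" by blast
    \<comment> \<open>The added 1 is there because the windows omit their right end.\<close>
    have "i \<in> {- int (nat \<bar>i\<bar> + 1)..<int (nat \<bar>i\<bar> + 1)}" by auto
    then have "sets (S k) \<subseteq> sets (generated M S (x ` {- int (nat \<bar>i\<bar> + 1)..<int (nat \<bar>i\<bar> + 1)}))"
      unfolding k by (intro sets_le_generated imageI)
    also have "\<dots> \<subseteq> (\<Union>n::nat. sets (generated M S (x ` {- int n..<int n})))"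
      by (rule UN_upper) simp
    finally show "sets (S k) \<subseteq> (\<Union>n::nat. sets (generated M S (x ` {- int n..<int n})))" .
  qed
  then show ?thesis unfolding sets_generated[of "range x"] by (rule sigma_sets_mono')
qed

text \<open>Covariance and standard deviations are the integrals in \<open>bound\<close> for the
  centred functions.\<close>

lemma (in prob_space) max_corr_le:
  assumes F: "subalgebra M F" and G: "subalgebra M G" and c: "0 \<le> c"
    and bound: "\<And>f g. \<lbrakk>f \<in> sq_integrable M F; g \<in> sq_integrable M G; expectation f = 0\<rbrakk> \<Longrightarrow>
      \<bar>\<integral>x. f x * g x \<partial>M\<bar> \<le> c * sqrt (\<integral>x. (f x)\<^sup>2 \<partial>M) * sqrt (\<integral>x. (g x)\<^sup>2 \<partial>M)"
  shows "max_corr M F G \<le> c"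
  unfolding max_corr_def
proof (rule cSup_least)
  fix r assume "r \<in> insert 0 {\<bar>covar M f g\<bar> / (sd M f * sd M g) | f g.
     f \<in> sq_integrable M F \<and> \<not> as_constant M f \<and> g \<in> sq_integrable M G \<and> \<not> as_constant M g}"
  then consider "r = 0" | f g where "r = \<bar>covar M f g\<bar> / (sd M f * sd M g)"
    "f \<in> sq_integrable M F" "g \<in> sq_integrable M G" by blast
  then show "r \<le> c"
  proof cases
    case 1
    then show ?thesis using c by simp
  next
    case (2 f g)
    have "expectation (\<lambda>x. f x - expectation f) = 0"
      using integrable_sq_integrable[OF sq_integrable_mono[OF 2(2) F]] by (simp add: prob_space)
    then have "\<bar>covar M f g\<bar> \<le> c * sd M f * sd M g"
      unfolding covar_def sd_def using 2
      by (intro bound sq_integrable_diff F G sq_integrable_const)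
    moreover have "0 \<le> sd M f * sd M g" by (simp add: sd_nonneg)
    \<comment> \<open>A vanishing denominator gives the quotient 0, which \<open>c\<close> also
      bounds.\<close>
    ultimately show ?thesis using c unfolding 2(1)
      by (cases "sd M f * sd M g = 0") (auto simp: divide_le_eq mult.assoc)
  qed
qed simp

lemma subalgebra_sigma_rv: "X \<in> measurable M N \<Longrightarrow> subalgebra M (sigma_rv M N X)"
  using sets_image_in_sets[of M "space M" X N] by (simp add: subalgebra_def)

text \<open>Each coordinate is measurable for the generated sigma-algebra, hence so is the vector,
  and the vector generates the smallest such sigma-algebra.\<close>

lemma (in subalgebra_family) sets_sigma_rv_PiM:
  assumes X: "\<And>i. X i \<in> measurable M (N i)" and S: "\<And>i. S (x i) = sigma_rv M (N i) (X i)"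
  shows "sets (sigma_rv M (PiM UNIV N) (\<lambda>\<omega> i. X i \<omega>)) \<subseteq> sets (generated M S (range x))"
proof -
  have "X i \<in> measurable (generated M S (range x)) (N i)" for i
  proof -
    have "X i \<in> measurable (S (x i)) (N i)"
      unfolding S using measurable_space[OF X[of i]] by (intro measurable_vimage_algebra1) auto
    moreover have "subalgebra (generated M S (range x)) (S (x i))"
      using sets_le_generated[of "x i" "range x"] sub[of "x i"]
      by (auto simp: subalgebra_def space_generated)
    ultimately show ?thesis using measurable_from_subalg by blast
  qed
  then have "(\<lambda>\<omega> i. X i \<omega>) \<in> measurable (generated M S (range x)) (PiM UNIV N)"
    by (intro measurable_PiM_single') (auto simp: space_generated measurable_space[OF X])
  then show ?thesis by (rule sets_image_in_sets[OF space_generated])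
qed

text \<open>The equation for \<open>ebar\<close> is stated in \<open>ennreal\<close>, where a
  divergent sum is infinite and the minimum becomes \<open>pi / 2\<close>.\<close>

theorem theorem3p3p10:
  fixes M :: "'w measure"
    and N :: "int \<Rightarrow> 'a measure" and X :: "int \<Rightarrow> 'w \<Rightarrow> 'a"
    and L :: "int \<Rightarrow> 'b measure" and Y :: "int \<Rightarrow> 'w \<Rightarrow> 'b"
    and \<epsilon> :: "int \<Rightarrow> real" and ebar :: real
  defines "\<M> \<equiv> metalgebra M
      (case_sum (\<lambda>i. sigma_rv M (N i) (X i)) (\<lambda>j. sigma_rv M (L j) (Y j))) UNIV"
  assumes "prob_space M"
    and "\<And>i. X i \<in> measurable M (N i)"
    and "\<And>j. Y j \<in> measurable M (L j)"
    and "\<And>z. 0 \<le> \<epsilon> z \<and> \<epsilon> z \<le> 1"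
    and "\<And>i j. meta_corr M (sigma_rv M (N i) (X i)) (sigma_rv M (L j) (Y j)) \<M> \<le> \<epsilon> (j - i)"
    and "0 \<le> ebar" and "ebar \<le> 1"
    and "ennreal (arcsin ebar) = min (\<Sum>\<^sub>\<infinity>z. ennreal (arcsin (\<epsilon> z))) (ennreal (pi / 2))"
  shows "max_corr M (sigma_rv M (PiM UNIV N) (\<lambda>\<omega> i. X i \<omega>))
                    (sigma_rv M (PiM UNIV L) (\<lambda>\<omega> j. Y j \<omega>)) \<le> ebar"
proof -
  define S where "S = case_sum (\<lambda>i. sigma_rv M (N i) (X i)) (\<lambda>j. sigma_rv M (L j) (Y j))"
  have S: "S (Inl i) = sigma_rv M (N i) (X i)" "S (Inr j) = sigma_rv M (L j) (Y j)" for i j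
    by (auto simp: S_def)
  interpret prob_space M by fact
  interpret subalgebra_family M S
  proof
    show "subalgebra M (S k)" for k
      using assms(3,4) by (cases k) (auto simp: S intro: subalgebra_sigma_rv)
  qed
  have corr: "cond_corr_le M (generated M S (insert (Inl i) K)) (generated M S (insert (Inr j) K))
      (generated M S K) (\<epsilon> (j - i))" for i j K
    using assms(6)[of i j] by (intro meta_corr_cond_corr_le) (simp add: S \<M>_def flip: S_def)
  \<comment> \<open>If \<open>ebar < 1\<close>, then the minimum lies below \<open>pi / 2\<close>
    and must be the infinite sum, which dominates its finite partial sums.\<close>
  have sum_le: "ebar = 1 \<or> (\<Sum>z\<in>Z. arcsin (\<epsilon> z)) \<le> arcsin ebar" if "finite Z" for Z
  proof (cases "ebar = 1")
    case False
    have as: "0 \<le> arcsin (\<epsilon> z)" for z using assms(5)[of z] arcsin_le_arcsin[of 0 "\<epsilon> z"] by simp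
    have e: "0 \<le> arcsin ebar" "arcsin ebar < pi / 2"
      using assms(7,8) False arcsin_le_arcsin[of 0 ebar] arcsin_less_arcsin[of ebar 1] by auto
    then have "ennreal (arcsin ebar) < ennreal (pi / 2)" by (intro ennreal_lessI) auto
    then have tot: "(\<Sum>\<^sub>\<infinity>z. ennreal (arcsin (\<epsilon> z))) = ennreal (arcsin ebar)"
      using assms(9) by (auto simp: min_def split: if_splits)
    have "ennreal (\<Sum>z\<in>Z. arcsin (\<epsilon> z)) = (\<Sum>z\<in>Z. ennreal (arcsin (\<epsilon> z)))"
      using as by (simp add: sum_ennreal)
    also have "\<dots> \<le> (\<Sum>\<^sub>\<infinity>z. ennreal (arcsin (\<epsilon> z)))"
      using that by (subst nonneg_infsum_complete) (auto intro: SUP_upper)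
    finally show ?thesis using tot e by (simp add: ennreal_le_iff)
  qed simp
  let ?F = "\<lambda>n. generated M S (Inl ` {- int n..<int n})"
  let ?G = "\<lambda>n. generated M S (Inr ` {- int n..<int n})"
  let ?X = "sigma_rv M (PiM UNIV N) (\<lambda>\<omega> i. X i \<omega>)" and ?Y = "sigma_rv M (PiM UNIV L) (\<lambda>\<omega> j. Y j \<omega>)"
  have le: "sets ?X \<subseteq> sets (generated M S (range Inl))" "sets ?Y \<subseteq> sets (generated M S (range Inr))"
    using sets_sigma_rv_PiM[where x = Inl and X = X and N = N]
      sets_sigma_rv_PiM[where x = Inr and X = Y and N = L] assms(3,4) S by auto
  have XM: "subalgebra M ?X" and YM: "subalgebra M ?Y"
    using le subalgebra_generated[of "range Inl"] subalgebra_generated[of "range Inr"]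
    by (auto simp: subalgebra_def)
  have dense: "sets ?X \<subseteq> sigma_sets (space M) (\<Union>n. sets (?F n))"
    "sets ?Y \<subseteq> sigma_sets (space M) (\<Union>n. sets (?G n))"
    using le sets_generated_range[of Inl] sets_generated_range[of Inr] by auto
  show ?thesis
  proof (rule max_corr_le[OF XM YM assms(7)])
    fix f g assume f: "f \<in> sq_integrable M ?X" and g: "g \<in> sq_integrable M ?Y"
      and f0: "expectation f = 0"
    show "\<bar>\<integral>x. f x * g x \<partial>M\<bar> \<le> ebar * sqrt (\<integral>x. (f x)\<^sup>2 \<partial>M) * sqrt (\<integral>x. (g x)\<^sup>2 \<partial>M)"
    \<comment> \<open>The windows of both families exhaust \<open>?X\<close> and \<open>?Y\<close>,
      so functions of finitely many variables are enough.\<close>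
    proof (rule correlation_bound_limit[where F = ?F and G = ?G,
          OF subalgebra_chain_windows subalgebra_chain_windows XM dense(1) YM dense(2) assms(7) _ f g f0])
      fix n h k
      assume h: "h \<in> sq_integrable M (?F n)" and k: "k \<in> sq_integrable M (?G n)"
        and h0: "expectation h = 0"
      show "\<bar>\<integral>x. h x * k x \<partial>M\<bar> \<le> ebar * sqrt (\<integral>x. (h x)\<^sup>2 \<partial>M) * sqrt (\<integral>x. (k x)\<^sup>2 \<partial>M)"
        by (rule window_correlation_bound[where \<epsilon> = \<epsilon> and x = Inl and y = Inr and n = n,
              OF assms(5) corr assms(7,8) sum_le h h0 k]) simp
    qed
  qed
qed

end
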